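(* Let $X$ be a real Banach space, let $B$ be a boundary for $X$ and let $A\subseteq X$ be bounded. Then the following assertions are equivalent: (i) $A$ is countably compact in the topology $\sigma_B$. (ii) For every sequence $(x_n)_{n\in\mathbb{N}}$ in $A$ we have $$A\cap \bigcap_{k=1}^{\infty} \overline{\operatorname{co}}^{\sigma_B}\{x_n : n\geq k\}\neq\emptyset.$$ (iii) For every sequence $(x_n)_{n\in\mathbb{N}}$ in $A$ there is some $x\in A$ with $$x^{*}(x)\leq \limsup_{n\to\infty} x^{*}(x_n)\quad \text{for all } x^{*}\in \operatorname{span} B.$$ (iv) $A$ is weakly compact.
   Context: $X^*$ is the dual of $X$ and $S_{X^*}$ its unit sphere. A subset $B\subseteq S_{X^*}$ is a boundary for $X$ if for every $x\in X$ there is some $b\in B$ with $b(x)=\|x\|$. $\sigma_B$ denotes the topology on $X$ of pointwise convergence on $B$. $\operatorname{co}$ denotes the convex hull and $\overline{\operatorname{co}}^{\sigma_B} C$ the $\sigma_B$-closure of $\operatorname{co} C$. $\operatorname{span} B$ is the linear span of $B$ in $X^*$. A set is countably compact in a topology if every sequence in it has a cluster point (in that topology) belonging to the set. *)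

theory Defs
  imports "HOL-Analysis.Analysis"
begin

definition is_boundary :: "('a::real_normed_vector \<Rightarrow>\<^sub>L real) set \<Rightarrow> bool" where
  "is_boundary B \<longleftrightarrow> B \<subseteq> sphere 0 1 \<and> (\<forall>x. \<exists>b\<in>B. blinfun_apply b x = norm x)"

text \<open>The topology of pointwise convergence on \<open>B\<close>, that is, the initial topology induced by
  the evaluation map \<open>x \<mapsto> (b x)\<^sub>b\<close> from \<open>X\<close> into the product space \<open>\<real>\<^sup>B\<close>. The restriction
  is needed because \<open>product_topology\<close> consists of functions that are undefined outside the
  index set.\<close>

definition sigma_topology :: "('a::real_normed_vector \<Rightarrow>\<^sub>L real) set \<Rightarrow> 'a topology" where
  "sigma_topology B =
     pullback_topology UNIV (\<lambda>x. \<lambda>b\<in>B. blinfun_apply b x) (product_topology (\<lambda>_. euclideanreal) B)"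

lemma topspace_sigma_topology [simp]: "topspace (sigma_topology B) = UNIV"
  unfolding sigma_topology_def topspace_pullback_topology by auto

lemma limitin_sigma_topology:
  "limitin (sigma_topology B) f l F \<longleftrightarrow>
     (\<forall>b\<in>B. ((\<lambda>i. blinfun_apply b (f i)) \<longlongrightarrow> blinfun_apply b l) F)"
proof -
  let ?e = "\<lambda>x. \<lambda>b\<in>B. blinfun_apply b x"
  have "limitin (sigma_topology B) f l F \<longleftrightarrow>
      limitin (product_topology (\<lambda>_. euclideanreal) B) (?e \<circ> f) (?e l) F"
    by (auto simp: limitin_def sigma_topology_def topspace_pullback_topology openin_pullback_topology)
  also have "\<dots> \<longleftrightarrow> (\<forall>b\<in>B. ((\<lambda>i. blinfun_apply b (f i)) \<longlongrightarrow> blinfun_apply b l) F)"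
    by (auto simp: limitin_componentwise)
  finally show ?thesis .
qed

definition weak_topology :: "'a::real_normed_vector topology" where
  "weak_topology = sigma_topology UNIV"

definition seq_cluster_point :: "'a topology \<Rightarrow> (nat \<Rightarrow> 'a) \<Rightarrow> 'a \<Rightarrow> bool" where
  "seq_cluster_point T s x \<longleftrightarrow> x \<in> topspace T \<and>
     (\<forall>U. openin T U \<and> x \<in> U \<longrightarrow> (\<exists>\<^sub>F n in sequentially. s n \<in> U))"

text \<open>Countable compactness in terms of cluster points of sequences, for an abstract topology;
  the library constant \<open>countably_compact\<close> uses countable covers and the type-class topology.\<close>

definition countably_compactin :: "'a topology \<Rightarrow> 'a set \<Rightarrow> bool" where
  "countably_compactin T S \<longleftrightarrow> S \<subseteq> topspace T \<and>
     (\<forall>s. range s \<subseteq> S \<longrightarrow> (\<exists>x\<in>S. seq_cluster_point T s x))"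

end

theory Submission
  imports Defs
begin

text \<open>Only one implication is deep: the condition (iii) forces \<open>A\<close> to be weakly compact. The other three are
soft: a cluster point lies in the closure of the convex hull of every tail, functionals in
\<open>span B\<close> are continuous for \<open>\<sigma>\<^sub>B\<close>, and \<open>\<sigma>\<^sub>B\<close> is coarser than the weak topology.

The main point is that every sequence \<open>x\<close> in \<open>A\<close> has a \<open>\<sigma>\<^sub>B\<close>-convergent subsequence. Say that
\<open>b \<in> B\<close> oscillates by \<open>d\<close> along an infinite set \<open>N\<close> of indices if, for some \<open>r\<close>, both
\<open>b (x k) \<le> r\<close> and \<open>b (x k) \<ge> r + d\<close> occur for infinitely many \<open>k \<in> N\<close>, and let \<open>osc N\<close> be the supremum of
these \<open>d\<close>. A diagonal argument (\<open>osc_stable_subset\<close>) gives \<open>N\<close> such that all infinite subsets of \<open>N\<close> have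
the same oscillation \<open>\<delta>\<close>, and it must be shown that \<open>\<delta> \<le> 0\<close>. Suppose that \<open>\<delta> > 0\<close>.

By Galvin's infinite Ramsey theorem (\<open>galvin_dichotomy\<close>) one may pass to a subset of \<open>N\<close> on which all finite
high/low patterns with gap \<open>d < \<delta>\<close> are realised by elements of \<open>B\<close> (\<open>splits_imp_shatters\<close>). This
bounds from below the norms of convex combinations of suitable differences, so that Simons' inequality
(\<open>simons_inequality\<close>) turns finite patterns into patterns on infinite sets
(\<open>simultaneous_oscillation\<close>). One obtains infinite sets \<open>U\<^sub>0, U\<^sub>1, \<dots>\<close> and
\<open>b\<^sub>m \<in> B\<close> such that \<open>b\<^sub>m\<close> is high, up to \<open>1 / (m + 1)\<close>, on almost all of \<open>U\<^sub>j\<close> for \<open>j \<le> m\<close> and low on almost all of \<open>U\<^sub>j\<close>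
for \<open>j > m\<close> (\<open>triangular_array\<close>).

The hypothesis is used next: choose \<open>u\<^sub>j \<in> A\<close> whose values under \<open>B\<close> lie between the lower and upper
limits along \<open>U\<^sub>j\<close>, and \<open>v \<in> A\<close> in the same position with respect to the sequence \<open>(u\<^sub>j)\<close>. The vector
\<open>G = \<Sum>\<^sub>j 2\<^sup>-\<^sup>j\<^sup>-\<^sup>1 (u\<^sub>j - v)\<close> has norm at least \<open>\<delta>\<close> because of the \<open>b\<^sub>m\<close>. On the
other hand, oscillation controls intermediate points without any error term: \<open>b (u\<^sub>j - v) \<le> \<delta>\<close> for
all \<open>b \<in> B\<close> (\<open>intermediate_diff_le_osc\<close>), although the \<open>x k\<close> themselves satisfy no such bound. Hence the
element of \<open>B\<close> at which \<open>G\<close> attains its norm satisfies \<open>b (u\<^sub>j) = b v + \<delta>\<close> for every \<open>j\<close>, which is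
impossible since \<open>b v\<close> is at least the lower limit of \<open>b (u\<^sub>j)\<close>. This is \<open>stable_osc_nonpos\<close>.

Simons' inequality upgrades \<open>\<sigma>\<^sub>B\<close>-convergence of bounded sequences to weak convergence (\<open>rainwater_simons\<close>),
and Whitley's proof of the Eberlein-Smulian theorem (\<open>bidual_limit_represented\<close>) passes from weak sequential compactness to
weak compactness. The Hahn-Banach theorem is avoided: the boundary supplies norming functionals, and Mazur's lemma is
replaced by \<open>boundary_mazur\<close>.\<close>

section \<open>Ramsey theory and diagonal arguments for infinite sets of naturals\<close>

definition members_above :: "nat set \<Rightarrow> nat set \<Rightarrow> nat set" where
  "members_above s M = {m \<in> M. \<forall>x\<in>s. x < m}"

lemma infinite_members_above:
  assumes "finite s" "infinite M"
  shows "infinite (members_above s M)"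
proof
  assume fin: "finite (members_above s M)"
  have "M \<subseteq> members_above s M \<union> (\<Union>x\<in>s. {..x})"
    by (force simp: members_above_def)
  moreover have "finite (members_above s M \<union> (\<Union>x\<in>s. {..x}))"
    using fin assms(1) by auto
  ultimately show False
    using assms(2) finite_subset by blast
qed

text \<open>The Mathias-style construction behind the Ramsey arguments. Choose \<open>e\<^sub>0 < e\<^sub>1 < \<dots>\<close> one at a time while shrinking the reservoir
of future elements so that \<open>D s\<close> holds for all subsets \<open>s\<close> of \<open>{..e\<^sub>n}\<close>, of which there are finitely many. If \<open>Max s = e\<^sub>n\<close>, the elements chosen
later all come from the reservoir made for \<open>s\<close>, and heredity only looks at those.\<close>

lemma fusion:
  fixes D :: "nat set \<Rightarrow> nat set \<Rightarrow> bool"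
  assumes ex: "\<And>s M. finite s \<Longrightarrow> infinite M \<Longrightarrow> \<exists>M'\<subseteq>M. infinite M' \<and> D s M'"
    and her: "\<And>s M N. finite s \<Longrightarrow> D s M \<Longrightarrow> infinite N \<Longrightarrow> members_above s N \<subseteq> M \<Longrightarrow> D s N"
    and inf: "infinite M"
  shows "\<exists>N\<subseteq>M. infinite N \<and> (\<forall>s. finite s \<longrightarrow> s \<subseteq> N \<longrightarrow> D s N)"
proof -
  have sub: "D s N" if "finite s" "D s M" "infinite N" "N \<subseteq> M" for s M N
    using her[OF that(1-3)] that(4) by (auto simp: members_above_def)
  have many: "\<exists>M'\<subseteq>M. infinite M' \<and> (\<forall>s\<in>S. D s M')"
    if "finite S" "\<forall>s\<in>S. finite s" "infinite M" for S M
    using that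
  proof (induction S)
    case empty
    then show ?case by auto
  next
    case (insert s S)
    then obtain M1 where M1: "M1 \<subseteq> M" "infinite M1" "\<forall>s\<in>S. D s M1" by auto
    obtain M2 where M2: "M2 \<subseteq> M1" "infinite M2" "D s M2"
      using ex[of s M1] insert.prems M1 by auto
    show ?case
      using M1 M2 sub insert.prems by (intro exI[of _ M2]) blast
  qed
  have step: "\<exists>M'. M' \<subseteq> M \<inter> {n<..} \<and> infinite M' \<and> (\<forall>s\<subseteq>{..n}. D s M')"
    if "infinite M" for M and n :: nat
  proof -
    have "infinite (M - {..n})" using that by simp
    moreover have "M - {..n} = M \<inter> {n<..}" by auto
    ultimately have "\<exists>M'\<subseteq>M \<inter> {n<..}. infinite M' \<and> (\<forall>s\<in>Pow {..n}. D s M')"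
      by (intro many) (auto intro: finite_subset)
    then show ?thesis by blast
  qed
  obtain M0 where M0: "M0 \<subseteq> M" "infinite M0" "D {} M0"
    using ex[of "{}" M] inf by auto
  define P where "P = (\<lambda>(n::nat) K. infinite K \<and> K \<subseteq> M0)"
  define Q where "Q = (\<lambda>(n::nat) K K'. K' \<subseteq> K \<inter> {Inf K<..} \<and> (\<forall>s\<subseteq>{..Inf K}. D s K'))"
  have "\<exists>f. \<forall>n. P n (f n) \<and> Q n (f n) (f (Suc n))"
  proof (rule dependent_nat_choice)
    show "\<exists>K. P 0 K" using M0 by (auto simp: P_def)
    show "\<exists>K'. P (Suc n) K' \<and> Q n K K'" if "P n K" for K n
      using step[of K "Inf K"] that unfolding P_def Q_def by blast
  qed
  then obtain f where f: "\<And>n. infinite (f n)" "\<And>n. f n \<subseteq> M0"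
      "\<And>n. f (Suc n) \<subseteq> f n" "\<And>n. f (Suc n) \<subseteq> {Inf (f n)<..}"
      "\<And>n s. s \<subseteq> {..Inf (f n)} \<Longrightarrow> D s (f (Suc n))"
    unfolding P_def Q_def by blast
  define e where "e = (\<lambda>n. Inf (f n))"
  have e_in: "e n \<in> f n" for n
    unfolding e_def using f(1)[of n] by (intro Inf_nat_def1) auto
  have anti: "f n \<subseteq> f m" if "m \<le> n" for m n
    using lift_Suc_antimono_le[of f, OF f(3) that] .
  have smono: "strict_mono e"
    unfolding strict_mono_Suc_iff using e_in f(4) unfolding e_def by blast
  have "D s (range e)" if s: "finite s" "s \<subseteq> range e" for s
  proof (cases "s = {}")
    case True
    have "members_above {} (range e) \<subseteq> M0" using e_in f(2) by (auto simp: members_above_def)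
    then show ?thesis
      using her[of "{}" M0 "range e"] True M0 range_inj_infinite strict_mono_imp_inj_on[OF smono] by auto
  next
    case False
    have "Max s \<in> range e" using Max_in[OF s(1) False] s(2) by blast
    then obtain k where k: "Max s = e k" by blast
    have "s \<subseteq> {..Inf (f k)}"
      using Max_ge[OF s(1)] k by (auto simp: e_def)
    then have D: "D s (f (Suc k))" by (rule f(5))
    have "members_above s (range e) \<subseteq> f (Suc k)"
    proof
      fix m assume "m \<in> members_above s (range e)"
      then obtain j where j: "m = e j" "e k < e j"
        using Max_in[OF s(1) False] k by (auto simp: members_above_def)
      then have "Suc k \<le> j" using smono by (simp add: strict_mono_less Suc_leI)
      then show "m \<in> f (Suc k)" using anti e_in j(1) by blast
    qed
    then show ?thesis
      using her[OF s(1) D] range_inj_infinite strict_mono_imp_inj_on[OF smono] by blast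
  qed
  moreover have "range e \<subseteq> M" using e_in f(2) M0(1) by blast
  moreover have "infinite (range e)" using range_inj_infinite strict_mono_imp_inj_on[OF smono] by blast
  ultimately show ?thesis by blast
qed

text \<open>Galvin's lemma, which gives the Ramsey property of open sets of infinite subsets of the naturals. The proof is Nash-Williams'
combinatorial forcing: \<open>M\<close> accepts a finite set \<open>s\<close> if all infinite continuations of \<open>s\<close> in \<open>M\<close> have an initial
segment in \<open>\<B>\<close>, and rejects \<open>s\<close> if no infinite subset of \<open>M\<close> accepts it. A first fusion yields a set that accepts or rejects each of its finite subsets; if it rejects the empty set,
a second fusion propagates rejection to all finite subsets, and a rejected set does not belong to \<open>\<B>\<close>.\<close>

lemma galvin_dichotomy:
  fixes \<B> :: "nat set set"
  assumes "infinite M"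
  shows "\<exists>N\<subseteq>M. infinite N \<and> ((\<forall>s. finite s \<longrightarrow> s \<subseteq> N \<longrightarrow> s \<notin> \<B>) \<or>
    (\<forall>L\<subseteq>N. infinite L \<longrightarrow> (\<exists>k. {x\<in>L. x < k} \<in> \<B>)))"
proof -
  define acc where "acc = (\<lambda>M s. \<forall>L\<subseteq>M. infinite L \<longrightarrow> (\<exists>k. {x \<in> s \<union> members_above s L. x < k} \<in> \<B>))"
  define rej where "rej = (\<lambda>M s. \<forall>N\<subseteq>M. infinite N \<longrightarrow> \<not> acc N s)"
  have acc_her: "acc N s" if "finite s" "acc M s" "members_above s N \<subseteq> M" for s M N
    unfolding acc_def
  proof (intro allI impI)
    fix L assume L: "L \<subseteq> N" "infinite L"
    have "members_above s L \<subseteq> M" "infinite (members_above s L)" "members_above s (members_above s L) = members_above s L"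
      using L that infinite_members_above by (auto simp: members_above_def)
    then show "\<exists>k. {x \<in> s \<union> members_above s L. x < k} \<in> \<B>"
      using that(2) unfolding acc_def by metis
  qed
  have rej_her: "rej N s" if "finite s" "rej M s" "members_above s N \<subseteq> M" for s M N
    unfolding rej_def
  proof (intro allI impI notI)
    fix L assume L: "L \<subseteq> N" "infinite L" "acc L s"
    have "acc (members_above s L) s" using acc_her[OF that(1) L(3)] by (auto simp: members_above_def)
    moreover have "members_above s L \<subseteq> M" "infinite (members_above s L)"
      using L that infinite_members_above by (auto simp: members_above_def)
    ultimately show False using that(2) unfolding rej_def by blast
  qed
  have "\<exists>N\<subseteq>M. infinite N \<and> (\<forall>s. finite s \<longrightarrow> s \<subseteq> N \<longrightarrow> acc N s \<or> rej N s)"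
  proof (rule fusion)
    show "\<exists>M'\<subseteq>M. infinite M' \<and> (acc M' s \<or> rej M' s)" if "infinite M" for s M
      using that unfolding rej_def by blast
    show "acc N s \<or> rej N s" if "finite s" "acc M s \<or> rej M s" "members_above s N \<subseteq> M" for s M N
      using that acc_her rej_her by blast
  qed (use assms in auto)
  then obtain N1 where N1: "N1 \<subseteq> M" "infinite N1" and
    dec: "\<And>s. finite s \<Longrightarrow> s \<subseteq> N1 \<Longrightarrow> acc N1 s \<or> rej N1 s" by blast
  show ?thesis
  proof (cases "acc N1 {}")
    case True
    then show ?thesis
      using N1 unfolding acc_def members_above_def by (intro exI[of _ N1]) simp
  next
    case False
    then have rej0: "rej N1 {}" using dec[of "{}"] by auto
    define D where "D = (\<lambda>s M. s \<subseteq> N1 \<and> rej N1 s \<longrightarrow> (\<forall>n\<in>members_above s M \<inter> N1. rej N1 (insert n s)))"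
    have "\<exists>N\<subseteq>N1. infinite N \<and> (\<forall>s. finite s \<longrightarrow> s \<subseteq> N \<longrightarrow> D s N)"
    proof (rule fusion)
      fix s M :: "nat set" assume s: "finite s" and M: "infinite M"
      show "\<exists>M'\<subseteq>M. infinite M' \<and> D s M'"
      proof (cases "s \<subseteq> N1 \<and> rej N1 s")
        case False
        then show ?thesis using M unfolding D_def by blast
      next
        case True
        define bad where "bad = {n \<in> members_above s M \<inter> N1. \<not> rej N1 (insert n s)}"
        have "finite bad"
        proof (rule ccontr)
          assume inf: "infinite bad"
          have "acc bad s"
            unfolding acc_def
          proof (intro allI impI)
            fix L assume L: "L \<subseteq> bad" "infinite L"
            define n where "n = Inf L"
            have n: "n \<in> L" "\<And>m. m \<in> L \<Longrightarrow> n \<le> m"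
              using L(2) Inf_nat_def1[of L] by (auto simp: n_def intro: cInf_lower)
            have "acc N1 (insert n s)"
              using n(1) L(1) dec[of "insert n s"] s True by (auto simp: bad_def)
            moreover have "L \<subseteq> N1" using L(1) by (auto simp: bad_def)
            ultimately have "\<exists>k. {x \<in> insert n s \<union> members_above (insert n s) L. x < k} \<in> \<B>"
              using L(2) unfolding acc_def by blast
            moreover have "insert n s \<union> members_above (insert n s) L = s \<union> members_above s L"
              using n L(1) by (fastforce simp: members_above_def bad_def nat_less_le)
            ultimately show "\<exists>k. {x \<in> s \<union> members_above s L. x < k} \<in> \<B>" by metis
          qed
          moreover have "bad \<subseteq> N1" by (auto simp: bad_def)
          ultimately show False using True inf unfolding rej_def by blast
        qed
        then have "infinite (M - bad)" using M by simp
        moreover have "D s (M - bad)"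
          by (auto simp: D_def bad_def members_above_def)
        ultimately show ?thesis by blast
      qed
    next
      show "D s N" if "D s M" "members_above s N \<subseteq> M" for s M N
        using that unfolding D_def members_above_def by blast
    qed (use N1 in auto)
    then obtain N where N: "N \<subseteq> N1" "infinite N" and
      D: "\<And>s. finite s \<Longrightarrow> s \<subseteq> N \<Longrightarrow> D s N" by blast
    have all_rej: "rej N1 s" if "finite s" "s \<subseteq> N" for s
      using that
    proof (induction s rule: finite_linorder_max_induct)
      case empty
      show ?case by (rule rej0)
    next
      case (insert b s)
      then have "D s N" "rej N1 s" "s \<subseteq> N1" "b \<in> members_above s N \<inter> N1"
        using D N(1) by (auto simp: members_above_def)
      then show ?case unfolding D_def by blast
    qed
    have "s \<notin> \<B>" if s: "finite s" "s \<subseteq> N" for s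
    proof
      assume "s \<in> \<B>"
      have "acc N1 s"
        unfolding acc_def
      proof (intro allI impI)
        fix L :: "nat set"
        obtain k where k: "\<And>x. x \<in> s \<Longrightarrow> x < k" "\<And>x. x \<in> members_above s L \<Longrightarrow> k \<le> x"
        proof (cases "s = {}")
          case True
          then show ?thesis using that[of 0] by auto
        next
          case False
          show ?thesis
          proof (rule that[of "Suc (Max s)"])
            show "x < Suc (Max s)" if "x \<in> s" for x
              using Max_ge[OF s(1) that] by simp
            show "Suc (Max s) \<le> x" if "x \<in> members_above s L" for x
              using that Max_in[OF s(1) False] by (auto simp: members_above_def Suc_le_eq)
          qed
        qed
        then have "{x \<in> s \<union> members_above s L. x < k} = s" by force
        then show "\<exists>k. {x \<in> s \<union> members_above s L. x < k} \<in> \<B>" using \<open>s \<in> \<B>\<close> by metis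
      qed
      then show False using all_rej[OF s] N1(2) unfolding rej_def by blast
    qed
    then show ?thesis using N N1(1) by blast
  qed
qed

text \<open>Countably many properties that are stable under almost inclusion and can each be achieved by shrinking can be achieved at once. It
is the fusion argument for a condition that depends on \<open>s\<close> through its cardinality only.\<close>

lemma diagonal_subset:
  fixes P :: "nat \<Rightarrow> nat set \<Rightarrow> bool"
  assumes ex: "\<And>n N. infinite N \<Longrightarrow> \<exists>N'\<subseteq>N. infinite N' \<and> P n N'"
    and her: "\<And>n N N'. P n N \<Longrightarrow> infinite N' \<Longrightarrow> finite (N' - N) \<Longrightarrow> P n N'"
    and inf: "infinite M"
  shows "\<exists>N\<subseteq>M. infinite N \<and> (\<forall>n. P n N)"
proof -
  have "\<exists>N\<subseteq>M. infinite N \<and> (\<forall>s. finite s \<longrightarrow> s \<subseteq> N \<longrightarrow> P (card s) N)"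
  proof (rule fusion)
    fix s M N :: "nat set"
    assume s: "finite s" and *: "P (card s) M" "infinite N" "members_above s N \<subseteq> M"
    have "N - M \<subseteq> (\<Union>x\<in>s. {..x})" using *(3) by (force simp: members_above_def)
    moreover have "finite (\<Union>x\<in>s. {..x})" using s by simp
    ultimately have "finite (N - M)" by (rule finite_subset)
    then show "P (card s) N" using her * by blast
  qed (use ex inf in auto)
  then show ?thesis by (metis infinite_arbitrarily_large)
qed

lemma pseudo_intersection:
  fixes S :: "nat \<Rightarrow> nat set"
  assumes "\<And>n. infinite (S n)" "\<And>n. S (Suc n) \<subseteq> S n"
  shows "\<exists>U. infinite U \<and> (\<forall>n. finite (U - S n))"
proof -
  have "\<exists>u. \<forall>n. u n \<in> S n \<and> u n < u (Suc n)"
  proof (rule dependent_nat_choice)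
    show "\<exists>x. x \<in> S 0" using assms(1)[of 0] by (metis finite.emptyI equals0I)
    show "\<exists>y. y \<in> S (Suc n) \<and> x < y" for x n
      using assms(1)[of "Suc n"] by (metis infinite_nat_iff_unbounded)
  qed
  then obtain u where u: "\<And>n. u n \<in> S n" "\<And>n. u n < u (Suc n)" by blast
  have sm: "strict_mono u" using u(2) by (simp add: strict_mono_Suc_iff)
  have anti: "S n \<subseteq> S m" if "m \<le> n" for m n
    using lift_Suc_antimono_le[of S, OF assms(2) that] .
  have "range u - S n \<subseteq> u ` {..<n}" for n
  proof
    fix k assume "k \<in> range u - S n"
    then obtain j where j: "k = u j" "u j \<notin> S n" by blast
    then have "\<not> n \<le> j" using anti u(1) by blast
    then show "k \<in> u ` {..<n}" using j(1) by simp
  qed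
  then have "finite (range u - S n)" for n
    by (rule finite_subset) auto
  then show ?thesis
    using range_inj_infinite strict_mono_imp_inj_on[OF sm] by blast
qed

text \<open>Approximate the infimum of \<open>F\<close> over subsets within \<open>1 / (n + 1)\<close>, for every \<open>n\<close>, and diagonalise; monotonicity up to finite sets lets
the diagonal set inherit all of these approximations.\<close>

lemma stable_subset:
  fixes F :: "nat set \<Rightarrow> real"
  assumes mono: "\<And>N N'. infinite N' \<Longrightarrow> finite (N' - N) \<Longrightarrow> F N' \<le> F N"
    and bdd: "\<And>N. infinite N \<Longrightarrow> c \<le> F N"
    and inf: "infinite M"
  shows "\<exists>N\<subseteq>M. infinite N \<and> (\<forall>N'\<subseteq>N. infinite N' \<longrightarrow> F N' = F N)"
proof -
  define P where "P = (\<lambda>n N. \<forall>N'\<subseteq>N. infinite N' \<longrightarrow> F N \<le> F N' + inverse (real (Suc n)))"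
  have "\<exists>N\<subseteq>M. infinite N \<and> (\<forall>n. P n N)"
  proof (rule diagonal_subset)
    fix n and N :: "nat set" assume N: "infinite N"
    define I where "I = F ` {N'. N' \<subseteq> N \<and> infinite N'}"
    have I: "I \<noteq> {}" "bdd_below I" using N bdd by (auto simp: I_def intro!: bdd_belowI[of _ c])
    have "\<exists>v\<in>I. v < Inf I + inverse (real (Suc n))"
      using I by (subst cInf_less_iff[symmetric]) auto
    then obtain N' where N': "N' \<subseteq> N" "infinite N'" "F N' < Inf I + inverse (real (Suc n))"
      by (auto simp: I_def)
    have "P n N'"
      unfolding P_def
    proof (intro allI impI)
      fix K assume "K \<subseteq> N'" "infinite K"
      then have "Inf I \<le> F K" using N' I by (intro cInf_lower) (auto simp: I_def)
      then show "F N' \<le> F K + inverse (real (Suc n))" using N'(3) by linarith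
    qed
    then show "\<exists>N'\<subseteq>N. infinite N' \<and> P n N'" using N' by blast
  next
    fix n and N N' :: "nat set"
    assume *: "P n N" "infinite N'" "finite (N' - N)"
    show "P n N'"
      unfolding P_def
    proof (intro allI impI)
      fix K assume K: "K \<subseteq> N'" "infinite K"
      have "K - N \<subseteq> N' - N" using K by auto
      then have "infinite (K \<inter> N)"
        using K(2) *(3) by (metis Diff_Diff_Int Diff_infinite_finite finite_subset)
      then have "F N \<le> F (K \<inter> N) + inverse (real (Suc n))"
        using *(1) by (auto simp: P_def)
      moreover have "F (K \<inter> N) \<le> F K" using \<open>infinite (K \<inter> N)\<close> by (intro mono) (auto simp: Int_Diff)
      moreover have "F N' \<le> F N" using * by (intro mono)
      ultimately show "F N' \<le> F K + inverse (real (Suc n))" by linarith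
    qed
  qed (rule inf)
  then obtain N where N: "N \<subseteq> M" "infinite N" "\<And>n. P n N" by blast
  have "F N' = F N" if N': "N' \<subseteq> N" "infinite N'" for N'
  proof (rule antisym)
    have "finite (N' - N)" using N'(1) by (metis Diff_eq_empty_iff finite.emptyI)
    then show "F N' \<le> F N" by (rule mono[OF N'(2)])
    show "F N \<le> F N'"
    proof (rule field_le_epsilon)
      fix e :: real assume "e > 0"
      then obtain n where "inverse (real (Suc n)) < e" using reals_Archimedean by blast
      moreover have "F N \<le> F N' + inverse (real (Suc n))"
        using N(3)[of n] N' by (simp add: P_def)
      ultimately show "F N \<le> F N' + e" by linarith
    qed
  qed
  then show ?thesis using N by blast
qed

section \<open>Simons' inequality\<close>

text \<open>This is the inequality \<open>sup\<^sub>B limsup b (y k) \<ge> inf \<parallel>co y\<parallel>\<close>. The vector to which the boundary is applied is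
\<open>G = \<Sum>\<^sub>n 2\<^sup>-\<^sup>n\<^sup>-\<^sup>1 g\<^sub>n\<close>, where \<open>g\<^sub>n\<close> lies in the convex hull of the \<open>n\<close>-th tail and
nearly minimises the norm of (partial sum) \<open>+ 2\<^sup>-\<^sup>n g\<close> over that hull. The remainder of the series is \<open>2\<^sup>-\<^sup>n\<close> times a limit of
points of the hull, so that the minimum is at most \<open>\<parallel>G\<parallel>\<close>. As a consequence, the norms of the partial sums stay below \<open>\<parallel>G\<parallel>\<close>
by about \<open>2\<^sup>-\<^sup>n \<theta>\<close>. If \<open>b \<in> B\<close> attains the norm of \<open>G\<close>, it must therefore be large on points of the hull of every tail.\<close>

lemma simons_inequality:
  fixes B :: "('a::banach \<Rightarrow>\<^sub>L real) set" and y :: "nat \<Rightarrow> 'a"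
  assumes B: "is_boundary B" and bdd: "bounded (range y)"
    and hull: "\<And>g. g \<in> convex hull (range y) \<Longrightarrow> \<theta> \<le> norm g" and "\<eta> > 0"
  shows "\<exists>b\<in>B. infinite {k. blinfun_apply b (y k) > \<theta> - \<eta>}"
proof (rule ccontr)
  assume "\<not> ?thesis"
  then have fin: "\<And>b. b \<in> B \<Longrightarrow> finite {k. blinfun_apply b (y k) > \<theta> - \<eta>}" by auto
  define C where "C = (\<lambda>n. convex hull (y ` {n..}))"
  define t :: "nat \<Rightarrow> real" where "t = (\<lambda>n. (1/2) ^ n)"
  have t_pos: "t n > 0" for n by (simp add: t_def)
  have t_Suc: "t (Suc n) = t n / 2" for n by (simp add: t_def)
  have t_0: "t 0 = 1" by (simp add: t_def)
  have t_le: "t n \<le> t m" if "m \<le> n" for m n using that by (simp add: t_def power_decreasing)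
  have t_lim: "t \<longlonglongrightarrow> 0" unfolding t_def by (rule LIMSEQ_power_zero) simp
  have C_mono: "C n \<subseteq> C m" if "m \<le> n" for m n
    using that by (auto simp: C_def intro!: hull_mono)
  have C_ne: "y n \<in> C n" for n by (auto simp: C_def intro!: hull_inc)
  have C_convex: "convex (C n)" for n by (simp add: C_def)
  have C_0: "C 0 = convex hull (range y)" by (simp add: C_def)
  obtain M where M: "\<And>n. norm (y n) \<le> M"
    using bdd by (auto simp: bounded_iff)
  have "convex hull (range y) \<subseteq> cball 0 M"
    using M by (intro hull_minimal) (auto simp: image_subset_iff)
  then have C_bdd: "norm c \<le> M" if "c \<in> C n" for c n
    using that C_mono[of 0 n] C_0 by auto
  \<comment> \<open>The tolerances are chosen so that, after multiplication by \<open>2\<^sup>n\<close>, they sum to \<open>\<eta> / 2\<close>.\<close>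
  define \<epsilon> where "\<epsilon> = (\<lambda>n. \<eta> / 2 * t (Suc n) * t n)"
  have "\<exists>h. \<forall>n. ((n = 0 \<longrightarrow> h n = 0)) \<and> (\<exists>g\<in>C n. h (Suc n) = h n + t (Suc n) *\<^sub>R g \<and>
      (\<forall>g'\<in>C n. norm (h n + t n *\<^sub>R g) \<le> norm (h n + t n *\<^sub>R g') + \<epsilon> n))"
  proof (rule dependent_nat_choice)
    fix h :: 'a and n
    define I where "I = (\<lambda>g. norm (h + t n *\<^sub>R g)) ` C n"
    have I: "I \<noteq> {}" "bdd_below I" using C_ne by (auto simp: I_def intro!: bdd_belowI[of _ 0])
    have "\<exists>v\<in>I. v < Inf I + \<epsilon> n"
      using I t_pos \<open>\<eta> > 0\<close> by (subst cInf_less_iff[symmetric]) (auto simp: \<epsilon>_def)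
    then obtain g where g: "g \<in> C n" "norm (h + t n *\<^sub>R g) < Inf I + \<epsilon> n" by (auto simp: I_def)
    have "norm (h + t n *\<^sub>R g) \<le> norm (h + t n *\<^sub>R g') + \<epsilon> n" if "g' \<in> C n" for g'
    proof -
      have "Inf I \<le> norm (h + t n *\<^sub>R g')" using I that by (intro cInf_lower) (auto simp: I_def)
      then show ?thesis using g(2) by linarith
    qed
    then show "\<exists>h'. (Suc n = 0 \<longrightarrow> h' = 0) \<and> (\<exists>g\<in>C n. h' = h + t (Suc n) *\<^sub>R g \<and>
      (\<forall>g'\<in>C n. norm (h + t n *\<^sub>R g) \<le> norm (h + t n *\<^sub>R g') + \<epsilon> n))"
      using g(1) by blast
  qed auto
  then obtain h where h0: "h 0 = 0" and hS: "\<And>n. \<exists>g\<in>C n. h (Suc n) = h n + t (Suc n) *\<^sub>R g \<and>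
      (\<forall>g'\<in>C n. norm (h n + t n *\<^sub>R g) \<le> norm (h n + t n *\<^sub>R g') + \<epsilon> n)" by metis
  then obtain g where g: "\<And>n. g n \<in> C n" "\<And>n. h (Suc n) = h n + t (Suc n) *\<^sub>R g n"
    "\<And>n g'. g' \<in> C n \<Longrightarrow> norm (h n + t n *\<^sub>R g n) \<le> norm (h n + t n *\<^sub>R g') + \<epsilon> n" by metis
  \<comment> \<open>The increment from \<open>h n\<close> to \<open>h (n + k)\<close> is a multiple of a single point of the hull of the \<open>n\<close>-th tail.\<close>
  have "\<exists>c\<in>C n. h (n + k) = h n + (t n - t (n + k)) *\<^sub>R c" for n k
  proof (induction k)
    case 0
    then show ?case using C_ne by auto
  next
    case (Suc k)
    then obtain c where c: "c \<in> C n" "h (n + k) = h n + (t n - t (n + k)) *\<^sub>R c" by blast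
    define a where "a = t n - t (n + Suc k)"
    have a: "a > 0" using t_le[of n "n + k"] t_Suc[of "n + k"] t_pos[of "n + k"] by (simp add: a_def)
    define c' where "c' = ((t n - t (n + k)) / a) *\<^sub>R c + (t (n + Suc k) / a) *\<^sub>R g (n + k)"
    have "c' \<in> C n"
      unfolding c'_def
    proof (rule convexD[OF C_convex c(1)])
      show "g (n + k) \<in> C n" using g(1) C_mono[of n "n + k"] by auto
      show "0 \<le> (t n - t (n + k)) / a" using t_le[of n "n + k"] a by simp
      show "0 \<le> t (n + Suc k) / a" using t_pos[of "n + Suc k"] a by simp
      have "t n - t (n + k) + t (n + Suc k) = a" using t_Suc[of "n + k"] by (simp add: a_def)
      then show "(t n - t (n + k)) / a + t (n + Suc k) / a = 1"
        using a by (simp add: add_divide_distrib[symmetric])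
    qed
    moreover have "h (n + Suc k) = h n + a *\<^sub>R c'"
      using g(2)[of "n + k"] c(2) a by (simp add: c'_def scaleR_add_right add.assoc)
    ultimately show ?case unfolding a_def by blast
  qed
  then obtain c where c: "\<And>n k. c n k \<in> C n" "\<And>n k. h (n + k) = h n + (t n - t (n + k)) *\<^sub>R c n k"
    by metis
  have "Cauchy h"
  proof (rule CauchyI')
    fix e :: real assume "e > 0"
    have "(\<lambda>n. t n * M) \<longlonglongrightarrow> 0 * M" by (intro tendsto_intros t_lim)
    then have "\<forall>\<^sub>F n in sequentially. t n * M < e" using \<open>e > 0\<close> by (auto intro: order_tendstoD)
    then obtain n0 where n0: "\<And>n. n \<ge> n0 \<Longrightarrow> t n * M < e" by (auto simp: eventually_sequentially)
    have "dist (h m) (h n) < e" if "m \<ge> n0" "n > m" for m n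
    proof -
      obtain k where k: "n = m + k" using \<open>n > m\<close> less_imp_add_positive by blast
      have "dist (h m) (h n) = (t m - t (m + k)) * norm (c m k)"
        using c(2)[of m k] t_le[of m "m + k"] by (simp add: k dist_norm)
      also have "\<dots> \<le> t m * M"
        using t_le[of m "m + k"] t_pos[of "m + k"] C_bdd[OF c(1)] by (intro mult_mono) (auto intro: less_imp_le)
      finally show ?thesis using n0[OF that(1)] by simp
    qed
    then show "\<exists>M. \<forall>m\<ge>M. \<forall>n>m. dist (h m) (h n) < e" by blast
  qed
  then obtain G where G: "h \<longlonglongrightarrow> G" using Cauchy_convergent convergent_def by blast
  have tail_lim: "(\<lambda>k. h n + t n *\<^sub>R c n k) \<longlonglongrightarrow> G" for n
  proof -
    have *: "h n + t n *\<^sub>R c n k = h (n + k) + t (n + k) *\<^sub>R c n k" for k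
      using c(2)[of n k] by (simp add: scaleR_diff_left)
    have "(\<lambda>k. t (n + k)) \<longlonglongrightarrow> 0" "(\<lambda>k. h (n + k)) \<longlonglongrightarrow> G"
      using LIMSEQ_ignore_initial_segment[OF t_lim, of n] LIMSEQ_ignore_initial_segment[OF G, of n]
      by (simp_all add: add.commute)
    moreover have "(\<lambda>k. t (n + k) *\<^sub>R c n k) \<longlonglongrightarrow> 0"
    proof (rule Lim_null_comparison)
      show "\<forall>\<^sub>F k in sequentially. norm (t (n + k) *\<^sub>R c n k) \<le> t (n + k) * M"
        using C_bdd[OF c(1)] t_pos by (auto intro!: always_eventually mult_left_mono simp: less_imp_le)
      show "(\<lambda>k. t (n + k) * M) \<longlonglongrightarrow> 0"
        using tendsto_mult[OF \<open>(\<lambda>k. t (n + k)) \<longlonglongrightarrow> 0\<close> tendsto_const[of M]] by simp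
    qed
    ultimately show ?thesis unfolding * using tendsto_add by fastforce
  qed
  have G_ge: "\<theta> \<le> norm G"
  proof (rule LIMSEQ_le_const)
    show "(\<lambda>k. norm (h 0 + t 0 *\<^sub>R c 0 k)) \<longlonglongrightarrow> norm G" by (intro tendsto_norm tail_lim)
    show "\<exists>N. \<forall>k\<ge>N. \<theta> \<le> norm (h 0 + t 0 *\<^sub>R c 0 k)"
      using hull c(1)[of 0] by (auto simp: h0 t_0 C_0)
  qed
  have opt: "norm (h n + t n *\<^sub>R g n) \<le> norm G + \<epsilon> n" for n
  proof (rule LIMSEQ_le_const)
    show "(\<lambda>k. norm (h n + t n *\<^sub>R c n k) + \<epsilon> n) \<longlonglongrightarrow> norm G + \<epsilon> n"
      by (intro tendsto_intros tail_lim)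
    show "\<exists>N. \<forall>k\<ge>N. norm (h n + t n *\<^sub>R g n) \<le> norm (h n + t n *\<^sub>R c n k) + \<epsilon> n"
      using g(3) c(1) by blast
  qed
  have growth: "norm (h n) \<le> norm G - t n * (\<theta> - \<eta> / 2 * (1 - t n))" for n
  proof (induction n)
    case 0
    then show ?case using G_ge by (simp add: h0 t_0)
  next
    case (Suc n)
    have "h (Suc n) = (1/2) *\<^sub>R h n + (1/2) *\<^sub>R (h n + t n *\<^sub>R g n)"
      by (simp add: g(2) t_Suc scaleR_add_right scaleR_add_left[symmetric] add.assoc[symmetric])
    then have "norm (h (Suc n)) \<le> norm (h n) / 2 + norm (h n + t n *\<^sub>R g n) / 2"
      using norm_triangle_ineq[of "(1/2) *\<^sub>R h n" "(1/2) *\<^sub>R (h n + t n *\<^sub>R g n)"] by simp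
    also have "\<dots> \<le> (norm G - t n * (\<theta> - \<eta> / 2 * (1 - t n))) / 2 + (norm G + \<epsilon> n) / 2"
      using Suc opt[of n] by (intro add_mono divide_right_mono) simp_all
    also have "\<dots> = norm G - t (Suc n) * (\<theta> - \<eta> / 2 * (1 - t (Suc n)))"
      by (simp add: t_Suc \<epsilon>_def field_simps)
    finally show ?case .
  qed
  obtain b where b: "b \<in> B" "blinfun_apply b G = norm G" and nb: "norm b = 1"
    using B unfolding is_boundary_def by (metis subsetD mem_sphere_0)
  obtain n where n: "\<And>k. k \<ge> n \<Longrightarrow> blinfun_apply b (y k) \<le> \<theta> - \<eta>"
  proof -
    obtain n where "\<And>k. k \<in> {k. blinfun_apply b (y k) > \<theta> - \<eta>} \<Longrightarrow> k < n"
      using fin[OF b(1)] by (metis finite_nat_bounded lessThan_iff subsetD)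
    then show ?thesis using that[of n] by (metis mem_Collect_eq not_less)
  qed
  have "C n \<subseteq> {c. blinfun_apply b c \<le> \<theta> - \<eta>}"
    unfolding C_def using n
  proof (intro hull_minimal)
    have "{c. blinfun_apply b c \<le> \<theta> - \<eta>} = blinfun_apply b -` {..\<theta> - \<eta>}" by auto
    then show "convex {c. blinfun_apply b c \<le> \<theta> - \<eta>}"
      using convex_linear_vimage[of "blinfun_apply b" "{..\<theta> - \<eta>}"]
      by (simp add: bounded_linear.linear blinfun.bounded_linear_right)
  qed auto
  then have bc: "blinfun_apply b (c n k) \<le> \<theta> - \<eta>" for k using c(1) by blast
  have "norm G \<le> norm (h n) + t n * (\<theta> - \<eta>)"
  proof (rule LIMSEQ_le_const2)
    show "(\<lambda>k. blinfun_apply b (h n + t n *\<^sub>R c n k)) \<longlonglongrightarrow> norm G"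
      using blinfun.tendsto[OF tendsto_const[of b] tail_lim[of n]] b(2) by simp
    have "blinfun_apply b (h n) \<le> norm (h n)" using norm_blinfun[of b "h n"] nb by simp
    then show "\<exists>N. \<forall>k\<ge>N. blinfun_apply b (h n + t n *\<^sub>R c n k) \<le> norm (h n) + t n * (\<theta> - \<eta>)"
      using bc t_pos[of n] by (auto simp: blinfun.add_right blinfun.scaleR_right intro!: exI[of _ 0] add_mono mult_left_mono)
  qed
  then have "t n * (\<theta> - \<eta> / 2 * (1 - t n)) \<le> t n * (\<theta> - \<eta>)" using growth[of n] by linarith
  then have "\<theta> - \<eta> / 2 * (1 - t n) \<le> \<theta> - \<eta>" using t_pos[of n] by (simp add: mult_le_cancel_left_pos)
  then have "\<eta> / 2 + \<eta> / 2 * t n \<le> 0" by (simp add: field_simps)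
  moreover have "\<eta> / 2 * t n > 0" using \<open>\<eta> > 0\<close> t_pos by simp
  ultimately show False using \<open>\<eta> > 0\<close> by linarith
qed

section \<open>Oscillation along sets of indices\<close>

definition splits :: "('a::real_normed_vector \<Rightarrow>\<^sub>L real) set \<Rightarrow> (nat \<Rightarrow> 'a) \<Rightarrow> real \<Rightarrow> nat set \<Rightarrow> bool" where
  "splits B x d N \<longleftrightarrow> (\<exists>b\<in>B. \<exists>r. infinite {k\<in>N. blinfun_apply b (x k) \<le> r} \<and>
     infinite {k\<in>N. r + d \<le> blinfun_apply b (x k)})"

definition osc :: "('a::real_normed_vector \<Rightarrow>\<^sub>L real) set \<Rightarrow> (nat \<Rightarrow> 'a) \<Rightarrow> nat set \<Rightarrow> real" where
  "osc B x N = Sup {d. splits B x d N}"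

text \<open>The values of \<open>B\<close> on \<open>(x k)\<close>, \<open>k \<in> M\<close>, are independent in the sense of Rosenthal, except that
the threshold \<open>r\<close> may depend on the pattern; only the gap \<open>d\<close> is fixed.\<close>

definition shatters :: "('a::real_normed_vector \<Rightarrow>\<^sub>L real) set \<Rightarrow> (nat \<Rightarrow> 'a) \<Rightarrow> real \<Rightarrow> nat set \<Rightarrow> bool" where
  "shatters B x d M \<longleftrightarrow> (\<forall>S T. finite S \<longrightarrow> finite T \<longrightarrow> S \<inter> T = {} \<longrightarrow> S \<subseteq> M \<longrightarrow> T \<subseteq> M \<longrightarrow>
     (\<exists>b\<in>B. \<exists>r. (\<forall>k\<in>S. r + d \<le> blinfun_apply b (x k)) \<and> (\<forall>k\<in>T. blinfun_apply b (x k) \<le> r)))"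

lemma splits_antimono:
  assumes "splits B x d N" "d' \<le> d"
  shows "splits B x d' N"
proof -
  obtain b r where b: "b \<in> B" "infinite {k\<in>N. blinfun_apply b (x k) \<le> r}"
    "infinite {k\<in>N. r + d \<le> blinfun_apply b (x k)}"
    using assms(1) by (auto simp: splits_def)
  have "{k\<in>N. r + d \<le> blinfun_apply b (x k)} \<subseteq> {k\<in>N. r + d' \<le> blinfun_apply b (x k)}"
    using assms(2) by auto
  then show ?thesis using b finite_subset unfolding splits_def by blast
qed

lemma splits_almost_subset:
  assumes "splits B x d N'" "finite (N' - N)"
  shows "splits B x d N"
proof -
  have *: "infinite {k\<in>N. P k}" if "infinite {k\<in>N'. P k}" for P
  proof -
    have "{k\<in>N'. P k} \<subseteq> {k\<in>N. P k} \<union> (N' - N)" by auto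
    then show ?thesis using that assms(2) by (meson finite_Un finite_subset)
  qed
  obtain b r where "b \<in> B" "infinite {k\<in>N'. blinfun_apply b (x k) \<le> r}"
      "infinite {k\<in>N'. r + d \<le> blinfun_apply b (x k)}"
    using assms(1) by (auto simp: splits_def)
  then show ?thesis unfolding splits_def by (intro bexI[of _ b] exI[of _ r] conjI *)
qed

context
  fixes B :: "('a::real_normed_vector \<Rightarrow>\<^sub>L real) set" and x :: "nat \<Rightarrow> 'a" and M :: real
  assumes eval_le: "\<forall>b\<in>B. \<forall>k. \<bar>blinfun_apply b (x k)\<bar> \<le> M" and ne: "B \<noteq> {}"
begin

lemma splits_le:
  assumes "splits B x d N"
  shows "d \<le> 2 * M"
proof -
  obtain b r where b: "b \<in> B" "infinite {k\<in>N. blinfun_apply b (x k) \<le> r}"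
    "infinite {k\<in>N. r + d \<le> blinfun_apply b (x k)}"
    using assms by (auto simp: splits_def)
  then obtain k l where "blinfun_apply b (x k) \<le> r" "r + d \<le> blinfun_apply b (x l)"
    using not_finite_existsD by blast
  then show ?thesis using eval_le[rule_format, OF b(1), of k] eval_le[rule_format, OF b(1), of l] by linarith
qed

lemma splits_trivial:
  assumes "infinite N"
  shows "splits B x (- 2 * M) N"
proof -
  obtain b where b: "b \<in> B" using ne by blast
  have bd: "blinfun_apply b (x k) \<le> M" "M + - 2 * M \<le> blinfun_apply b (x k)" for k
    using eval_le[rule_format, OF b, of k] by linarith+
  show ?thesis
    unfolding splits_def by (intro bexI[OF _ b] exI[of _ M]) (simp only: bd simp_thms Collect_mem_eq assms not_False_eq_True)
qed

lemma bdd_above_splits: "bdd_above {d. splits B x d N}"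
  using splits_le by (auto intro: bdd_aboveI[of _ "2 * M"])

lemma splits_le_osc: "splits B x d N \<Longrightarrow> d \<le> osc B x N"
  unfolding osc_def using bdd_above_splits by (auto intro: cSup_upper)

lemma less_osc_splits:
  assumes "infinite N" "d < osc B x N"
  shows "splits B x d N"
proof -
  have "{d. splits B x d N} \<noteq> {}" using splits_trivial[OF assms(1)] by blast
  then obtain d' where "splits B x d' N" "d < d'"
    using less_cSupD[of "{d. splits B x d N}" d] assms(2) unfolding osc_def by blast
  then show ?thesis by (intro splits_antimono[of B x d' N d]) auto
qed

lemma osc_mono:
  assumes "infinite N'" "finite (N' - N)"
  shows "osc B x N' \<le> osc B x N"
  unfolding osc_def
proof (rule cSup_subset_mono)
  show "{d. splits B x d N'} \<noteq> {}" using splits_trivial[OF assms(1)] by blast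
  show "{d. splits B x d N'} \<subseteq> {d. splits B x d N}" using splits_almost_subset assms(2) by blast
qed (rule bdd_above_splits)

lemma osc_ge: "infinite N \<Longrightarrow> - 2 * M \<le> osc B x N"
  by (rule splits_le_osc[OF splits_trivial])

lemma osc_stable_subset:
  assumes "infinite L"
  shows "\<exists>N\<subseteq>L. infinite N \<and> (\<forall>N'\<subseteq>N. infinite N' \<longrightarrow> osc B x N' = osc B x N)"
  by (rule stable_subset[OF osc_mono osc_ge assms])

text \<open>The threshold \<open>r\<close> is slightly below the lower limit of \<open>b (x k)\<close> along \<open>N\<close>; exceeding \<open>r + osc B x N + e\<close> infinitely often would
make \<open>b\<close> oscillate by more than \<open>osc B x N\<close>.\<close>

lemma osc_range:
  assumes b: "b \<in> B" and N: "infinite N" and e: "e > 0"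
  shows "\<exists>r. finite {k\<in>N. blinfun_apply b (x k) < r \<or> r + osc B x N + e < blinfun_apply b (x k)}"
proof -
  define I where "I = {c. finite {k\<in>N. blinfun_apply b (x k) < c}}"
  have bd: "blinfun_apply b (x k) < M + 1" "\<not> blinfun_apply b (x k) < - M" for k
    using eval_le[rule_format, OF b, of k] by linarith+
  have "{k\<in>N. blinfun_apply b (x k) < - M} = {}"
    using bd by blast
  then have "- M \<in> I" unfolding I_def by (metis finite.emptyI mem_Collect_eq)
  moreover have "c \<le> M + 1" if "c \<in> I" for c
  proof (rule ccontr)
    assume "\<not> c \<le> M + 1"
    then have "blinfun_apply b (x k) < c" for k using bd(1)[of k] by linarith
    then have "{k\<in>N. blinfun_apply b (x k) < c} = N" by blast
    then show False using that N by (simp add: I_def)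
  qed
  ultimately have I: "I \<noteq> {}" "bdd_above I" by (auto intro: bdd_aboveI[of _ "M + 1"])
  define r where "r = Sup I - e / 2"
  have "r < Sup I" using e by (simp add: r_def)
  then obtain c where c: "c \<in> I" "r < c" using less_cSupD[OF I(1)] by blast
  have "{k\<in>N. blinfun_apply b (x k) < r} \<subseteq> {k\<in>N. blinfun_apply b (x k) < c}" using c(2) by auto
  then have low: "finite {k\<in>N. blinfun_apply b (x k) < r}"
    using c(1) finite_subset unfolding I_def by blast
  have "Sup I + e / 4 \<notin> I" using cSup_upper[OF _ I(2), of "Sup I + e / 4"] e by auto
  then have "infinite {k\<in>N. blinfun_apply b (x k) < Sup I + e / 4}" by (simp add: I_def)
  then have inf: "infinite {k\<in>N. blinfun_apply b (x k) \<le> Sup I + e / 4}"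
    by (rule contrapos_nn) (auto elim: finite_subset[rotated])
  have high: "finite {k\<in>N. r + osc B x N + e < blinfun_apply b (x k)}"
  proof (rule ccontr)
    assume *: "infinite {k\<in>N. r + osc B x N + e < blinfun_apply b (x k)}"
    have "{k\<in>N. r + osc B x N + e < blinfun_apply b (x k)} \<subseteq>
        {k\<in>N. (Sup I + e / 4) + (osc B x N + e / 4) \<le> blinfun_apply b (x k)}"
      by (auto simp: r_def)
    then have "infinite {k\<in>N. (Sup I + e / 4) + (osc B x N + e / 4) \<le> blinfun_apply b (x k)}"
      using * finite_subset by blast
    then have "splits B x (osc B x N + e / 4) N" using inf b unfolding splits_def by blast
    then show False using splits_le_osc e by force
  qed
  have "{k\<in>N. blinfun_apply b (x k) < r \<or> r + osc B x N + e < blinfun_apply b (x k)} =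
      {k\<in>N. blinfun_apply b (x k) < r} \<union> {k\<in>N. r + osc B x N + e < blinfun_apply b (x k)}" by auto
  then show ?thesis using low high by (intro exI[of _ r]) simp
qed

end

lemma shatters_subset:
  assumes "shatters B x d M" "N \<subseteq> M"
  shows "shatters B x d N"
  unfolding shatters_def
proof (intro allI impI)
  fix S T assume "finite S" "finite T" "S \<inter> T = {}" "S \<subseteq> N" "T \<subseteq> N"
  then show "\<exists>b\<in>B. \<exists>r. (\<forall>k\<in>S. r + d \<le> blinfun_apply b (x k)) \<and> (\<forall>k\<in>T. blinfun_apply b (x k) \<le> r)"
    using assms(1)[unfolded shatters_def, rule_format, of S T] assms(2) by simp
qed

text \<open>Call a finite set alternating if some \<open>b \<in> B\<close> is alternately high and low on it. Interleaving the two index sets given by \<open>splits\<close> shows that every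
infinite subset of \<open>N\<close> contains an infinite set all of whose initial segments are alternating, so Galvin's dichotomy leaves a set \<open>K\<close> all of whose finite subsets
are alternating. Arbitrary patterns on every third element of \<open>K\<close> are restrictions of alternating ones, the other
elements of \<open>K\<close> serving to correct the parity.\<close>

lemma splits_imp_shatters:
  assumes N: "infinite N" and spl: "\<forall>N'\<subseteq>N. infinite N' \<longrightarrow> splits B x d N'"
  shows "\<exists>M\<subseteq>N. infinite M \<and> shatters B x d M"
proof -
  define alt where "alt = (\<lambda>s::nat set. \<exists>b\<in>B. \<exists>r. \<forall>k\<in>s.
     (even (card {l\<in>s. l < k}) \<longrightarrow> r + d \<le> blinfun_apply b (x k)) \<and>
     (odd (card {l\<in>s. l < k}) \<longrightarrow> blinfun_apply b (x k) \<le> r))"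
  have ex_alt: "\<exists>L\<subseteq>N'. infinite L \<and> (\<forall>k. alt {y\<in>L. y < k})" if N': "N' \<subseteq> N" "infinite N'" for N'
  proof -
    obtain b r where b: "b \<in> B" "infinite {k\<in>N'. blinfun_apply b (x k) \<le> r}"
        "infinite {k\<in>N'. r + d \<le> blinfun_apply b (x k)}"
      using spl[rule_format, OF N'] unfolding splits_def by blast
    define P where "P = (\<lambda>i::nat. if even i then {k\<in>N'. r + d \<le> blinfun_apply b (x k)}
        else {k\<in>N'. blinfun_apply b (x k) \<le> r})"
    have infP: "infinite (P i)" for i using b by (simp add: P_def)
    have "\<exists>e. \<forall>i. e i \<in> P i \<and> e i < e (Suc i)"
    proof (rule dependent_nat_choice)
      show "\<exists>v. v \<in> P 0" using infP[of 0] by (metis finite.emptyI equals0I)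
      show "\<exists>w. w \<in> P (Suc i) \<and> v < w" for v i
        using infP[of "Suc i"] by (metis infinite_nat_iff_unbounded)
    qed
    then obtain e where e: "\<And>i. e i \<in> P i" "\<And>i. e i < e (Suc i)" by blast
    have sm: "strict_mono e" using e(2) by (simp add: strict_mono_Suc_iff)
    have "alt {y \<in> range e. y < k}" for k
      unfolding alt_def
    proof (intro bexI[OF _ b(1)] exI[of _ r] ballI)
      fix m assume "m \<in> {y \<in> range e. y < k}"
      then obtain i where i: "m = e i" "e i < k" by blast
      have "{l \<in> {y \<in> range e. y < k}. l < m} = e ` {..<i}"
        using i sm by (auto simp: strict_mono_less intro: order.strict_trans[of _ "e i" k])
      then have "card {l \<in> {y \<in> range e. y < k}. l < m} = i"
        using card_image[of e "{..<i}"] strict_mono_imp_inj_on[OF sm] by (simp add: inj_on_subset)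
      then show "(even (card {l \<in> {y \<in> range e. y < k}. l < m}) \<longrightarrow> r + d \<le> blinfun_apply b (x m)) \<and>
          (odd (card {l \<in> {y \<in> range e. y < k}. l < m}) \<longrightarrow> blinfun_apply b (x m) \<le> r)"
        using e(1)[of i] i(1) by (simp add: P_def split: if_splits)
    qed
    moreover have "P i \<subseteq> N'" for i by (auto simp: P_def)
    then have "range e \<subseteq> N'" using e(1) by blast
    ultimately show ?thesis
      using range_inj_infinite strict_mono_imp_inj_on[OF sm] by blast
  qed
  obtain K where K: "K \<subseteq> N" "infinite K" "\<And>s. finite s \<Longrightarrow> s \<subseteq> K \<Longrightarrow> alt s"
  proof -
    obtain K where K: "K \<subseteq> N" "infinite K" and
      dich: "(\<forall>s. finite s \<longrightarrow> s \<subseteq> K \<longrightarrow> s \<notin> {s. \<not> alt s}) \<or>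
        (\<forall>L\<subseteq>K. infinite L \<longrightarrow> (\<exists>k. {y\<in>L. y < k} \<in> {s. \<not> alt s}))"
      using galvin_dichotomy[OF N, of "{s. \<not> alt s}"] by metis
    obtain L where L: "L \<subseteq> K" "infinite L" "\<And>k. alt {y\<in>L. y < k}" using ex_alt[OF K] by metis
    have neg: "\<not> (\<forall>L\<subseteq>K. infinite L \<longrightarrow> (\<exists>k. {y\<in>L. y < k} \<in> {s. \<not> alt s}))"
      using L by (metis mem_Collect_eq)
    have pos: "\<forall>s. finite s \<longrightarrow> s \<subseteq> K \<longrightarrow> s \<notin> {s. \<not> alt s}"
      using dich
    proof
      assume "\<forall>L\<subseteq>K. infinite L \<longrightarrow> (\<exists>k. {y\<in>L. y < k} \<in> {s. \<not> alt s})"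
      with neg show ?thesis by (rule notE)
    qed
    show ?thesis
    proof (rule that[OF K])
      show "alt s" if "finite s" "s \<subseteq> K" for s using pos that by simp
    qed
  qed
  define e where "e = enumerate K"
  have sm: "strict_mono e" unfolding e_def using K(2) by (rule strict_mono_enumerate)
  have inj: "inj e" using sm by (rule strict_mono_imp_inj_on)
  have eK: "e i \<in> K" for i unfolding e_def using K(2) by (rule enumerate_in_set)
  define M where "M = range (\<lambda>j. e (3 * j + 1))"
  have "infinite M"
    unfolding M_def by (intro range_inj_infinite injI) (auto dest!: injD[OF inj])
  moreover have "M \<subseteq> N" using eK K(1) by (auto simp: M_def)
  moreover have "shatters B x d M"
    unfolding shatters_def
  proof (intro allI impI)
    fix S T assume S: "finite S" and T: "finite T" and disj: "S \<inter> T = {}" and sub: "S \<subseteq> M" "T \<subseteq> M"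
    define J where "J = {j. e (3 * j + 1) \<in> S \<union> T}"
    \<comment> \<open>Blocks of two elements keep the rank of later elements even; in its block, \<open>e (3 * j + 1)\<close> comes first if it has to be high and second if it has to be low.\<close>
    define blk where "blk = (\<lambda>j::nat. if e (3 * j + 1) \<in> S then {3 * j + 1, 3 * j + 2} else {3 * j, 3 * j + 1})"
    define I where "I = (\<Union>j\<in>J. blk j)"
    have "finite J"
      unfolding J_def using S T
      by (intro finite_vimageI[of "S \<union> T" "\<lambda>j. e (3 * j + 1)", unfolded vimage_def] injI)
        (auto dest!: injD[OF inj])
    then have finI: "finite I" by (auto simp: I_def blk_def)
    have even_blocks: "even (card (\<Union>l\<in>{l\<in>J. l < j}. blk l))" for j
    proof -
      have "card (\<Union>l\<in>{l\<in>J. l < j}. blk l) = (\<Sum>l\<in>{l\<in>J. l < j}. card (blk l))"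
        using \<open>finite J\<close> by (intro card_UN_disjoint) (auto simp: blk_def)
      also have "\<dots> = (\<Sum>l\<in>{l\<in>J. l < j}. 2)" by (intro sum.cong) (auto simp: blk_def)
      finally show ?thesis by simp
    qed
    have blk_bounds: "3 * j \<le> l \<and> l < 3 * j + 3" if "l \<in> blk j" for j l
      using that by (auto simp: blk_def split: if_splits)
    have below: "{l \<in> I. l < 3 * j + 1} = (\<Union>l\<in>{l\<in>J. l < j}. blk l) \<union> {l \<in> blk j. l < 3 * j + 1}"
      if j: "j \<in> J" for j
    proof (intro subset_antisym subsetI)
      fix l assume "l \<in> {l \<in> I. l < 3 * j + 1}"
      then obtain i where i: "i \<in> J" "l \<in> blk i" "l < 3 * j + 1" by (auto simp: I_def)
      then have "i < j \<or> i = j" using blk_bounds[OF i(2)] by auto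
      then show "l \<in> (\<Union>l\<in>{l\<in>J. l < j}. blk l) \<union> {l \<in> blk j. l < 3 * j + 1}" using i by auto
    next
      fix l assume "l \<in> (\<Union>l\<in>{l\<in>J. l < j}. blk l) \<union> {l \<in> blk j. l < 3 * j + 1}"
      then consider i where "i \<in> J" "i < j" "l \<in> blk i" | "l \<in> blk j" "l < 3 * j + 1" by blast
      then show "l \<in> {l \<in> I. l < 3 * j + 1}"
      proof cases
        case 1
        then have "l < 3 * j + 1" using blk_bounds[of l i] by linarith
        then show ?thesis using 1 by (auto simp: I_def)
      qed (use j in \<open>auto simp: I_def\<close>)
    qed
    have card_e: "card {l \<in> e ` I. l < e i} = card {l \<in> I. l < i}" for i
    proof -
      have "{l \<in> e ` I. l < e i} = e ` {l \<in> I. l < i}" using sm by (auto simp: strict_mono_less)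
      then show ?thesis using inj by (simp add: card_image inj_on_subset)
    qed
    have "finite (e ` I)" "e ` I \<subseteq> K" using finI eK by auto
    then obtain b r where b: "b \<in> B" and r:
        "\<And>k. k \<in> e ` I \<Longrightarrow> even (card {l \<in> e ` I. l < k}) \<Longrightarrow> r + d \<le> blinfun_apply b (x k)"
        "\<And>k. k \<in> e ` I \<Longrightarrow> odd (card {l \<in> e ` I. l < k}) \<Longrightarrow> blinfun_apply b (x k) \<le> r"
      using K(3)[of "e ` I"] unfolding alt_def by blast
    have "r + d \<le> blinfun_apply b (x k)" if k: "k \<in> S" for k
    proof -
      obtain j where j: "k = e (3 * j + 1)" "j \<in> J" using k sub by (auto simp: M_def J_def)
      have "{l \<in> blk j. l < 3 * j + 1} = {}" using j(1) k by (auto simp: blk_def)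
      then have "{l \<in> I. l < 3 * j + 1} = (\<Union>l\<in>{l\<in>J. l < j}. blk l)"
        unfolding below[OF j(2)] by (simp only: Un_empty_right Un_insert_right)
      moreover have "3 * j + 1 \<in> I" using j(2) unfolding I_def blk_def by (intro UN_I[of j]) auto
      ultimately show ?thesis using r(1)[of k] even_blocks[of j] card_e[of "3 * j + 1"] j(1) by auto
    qed
    moreover have "blinfun_apply b (x k) \<le> r" if k: "k \<in> T" for k
    proof -
      obtain j where j: "k = e (3 * j + 1)" "j \<in> J" using k sub by (auto simp: M_def J_def)
      have nS: "e (3 * j + 1) \<notin> S" using k j disj by auto
      have "{l \<in> blk j. l < 3 * j + 1} = {3 * j}" using nS by (auto simp: blk_def)
      then have "{l \<in> I. l < 3 * j + 1} = insert (3 * j) (\<Union>l\<in>{l\<in>J. l < j}. blk l)"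
        unfolding below[OF j(2)] by (simp only: Un_empty_right Un_insert_right)
      moreover have "3 * j \<notin> (\<Union>l\<in>{l\<in>J. l < j}. blk l)" using blk_bounds by fastforce
      moreover have "finite (\<Union>l\<in>{l\<in>J. l < j}. blk l)" using \<open>finite J\<close> by (auto simp: blk_def)
      moreover have "3 * j + 1 \<in> I" using j(2) unfolding I_def blk_def by (intro UN_I[of j]) auto
      ultimately show ?thesis using r(2)[of k] even_blocks[of j] card_e[of "3 * j + 1"] j(1) by auto
    qed
    ultimately show "\<exists>b\<in>B. \<exists>r. (\<forall>k\<in>S. r + d \<le> blinfun_apply b (x k)) \<and> (\<forall>k\<in>T. blinfun_apply b (x k) \<le> r)"
      using b by blast
  qed
  ultimately show ?thesis by blast
qed

section \<open>Intermediate points and independent blocks\<close>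

text \<open>\<open>liminf b (x k) \<le> b y \<le> limsup b (x k)\<close> along \<open>N\<close>, for all \<open>b \<in> B\<close>, expressed without limits: a bound
that holds for almost all \<open>k \<in> N\<close> passes to \<open>y\<close>.\<close>

definition intermediate ::
    "('a::real_normed_vector \<Rightarrow>\<^sub>L real) set \<Rightarrow> (nat \<Rightarrow> 'a) \<Rightarrow> nat set \<Rightarrow> 'a \<Rightarrow> bool" where
  "intermediate B x N y \<longleftrightarrow> (\<forall>b\<in>B. \<forall>c.
     (finite {k\<in>N. c < blinfun_apply b (x k)} \<longrightarrow> blinfun_apply b y \<le> c) \<and>
     (finite {k\<in>N. blinfun_apply b (x k) < c} \<longrightarrow> c \<le> blinfun_apply b y))"

lemma intermediate_le:
  assumes "intermediate B x N y" "b \<in> B" "finite {k\<in>N. c < blinfun_apply b (x k)}"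
  shows "blinfun_apply b y \<le> c"
  using assms unfolding intermediate_def by blast

lemma intermediate_ge:
  assumes "intermediate B x N y" "b \<in> B" "finite {k\<in>N. blinfun_apply b (x k) < c}"
  shows "c \<le> blinfun_apply b y"
  using assms unfolding intermediate_def by blast

lemma intermediate_almost_superset:
  assumes "intermediate B x N' y" "finite (N' - N)"
  shows "intermediate B x N y"
proof -
  have *: "finite {k\<in>N'. P k}" if "finite {k\<in>N. P k}" for P
  proof -
    have "{k\<in>N'. P k} \<subseteq> {k\<in>N. P k} \<union> (N' - N)" by auto
    then show ?thesis using that assms(2) by (meson finite_Un finite_subset)
  qed
  show ?thesis
    unfolding intermediate_def
    using intermediate_le[OF assms(1)] intermediate_ge[OF assms(1)] * by simp
qed

lemma intermediate_enumerate:
  assumes "intermediate B (x \<circ> enumerate N) UNIV y" "infinite N"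
  shows "intermediate B x N y"
proof -
  have inj: "inj (enumerate N)"
    using strict_mono_enumerate[OF assms(2)] by (rule strict_mono_imp_inj_on)
  have *: "finite {i \<in> UNIV. P ((x \<circ> enumerate N) i)}" if fin: "finite {k\<in>N. P (x k)}" for P
  proof -
    have "enumerate N ` {i \<in> UNIV. P ((x \<circ> enumerate N) i)} \<subseteq> {k\<in>N. P (x k)}"
      using enumerate_in_set[OF assms(2)] by auto
    then show ?thesis using fin inj by (meson finite_imageD finite_subset inj_on_subset subset_UNIV)
  qed
  have "blinfun_apply b y \<le> c" if "b \<in> B" "finite {k\<in>N. c < blinfun_apply b (x k)}" for b c
    using intermediate_le[OF assms(1) that(1)] *[of "\<lambda>z. c < blinfun_apply b z", OF that(2)] by blast
  moreover have "c \<le> blinfun_apply b y" if "b \<in> B" "finite {k\<in>N. blinfun_apply b (x k) < c}" for b c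
    using intermediate_ge[OF assms(1) that(1)] *[of "\<lambda>z. blinfun_apply b z < c", OF that(2)] by blast
  ultimately show ?thesis unfolding intermediate_def by simp
qed

lemma split_infinite_nat_set:
  fixes A :: "nat set"
  assumes "infinite A"
  obtains A1 A2 where "A1 \<subseteq> A" "A2 \<subseteq> A" "infinite A1" "infinite A2" "A1 \<inter> A2 = {}"
proof -
  have inj: "inj (enumerate A)"
    using strict_mono_enumerate[OF assms] by (rule strict_mono_imp_inj_on)
  have "infinite (range (\<lambda>i. enumerate A (2 * i)))" "infinite (range (\<lambda>i. enumerate A (2 * i + 1)))"
    by (auto intro!: range_inj_infinite injI dest!: injD[OF inj])
  moreover have "range (\<lambda>i. enumerate A (2 * i)) \<inter> range (\<lambda>i. enumerate A (2 * i + 1)) = {}"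
  proof -
    have "enumerate A (2 * i) \<noteq> enumerate A (2 * j + 1)" for i j
      using inj by (simp add: inj_eq) presburger
    then show ?thesis by blast
  qed
  ultimately show ?thesis
    using that enumerate_in_set[OF assms] by (metis image_subsetI)
qed

lemma shatters_antimono:
  assumes "shatters B x d M" "d' \<le> d"
  shows "shatters B x d' M"
  unfolding shatters_def
proof (intro allI impI)
  fix S T assume "finite S" "finite T" "S \<inter> T = {}" "S \<subseteq> M" "T \<subseteq> M"
  then obtain b r where "b \<in> B" "\<forall>k\<in>S. r + d \<le> blinfun_apply b (x k)" "\<forall>k\<in>T. blinfun_apply b (x k) \<le> r"
    using assms(1)[unfolded shatters_def, rule_format, of S T] by auto
  then show "\<exists>b\<in>B. \<exists>r. (\<forall>k\<in>S. r + d' \<le> blinfun_apply b (x k)) \<and> (\<forall>k\<in>T. blinfun_apply b (x k) \<le> r)"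
    using assms(2) by (intro bexI[of _ b] exI[of _ r]) force+
qed

lemma convex_hull_range_finite:
  fixes y :: "nat \<Rightarrow> 'a::real_vector"
  assumes "g \<in> convex hull (range y)"
  obtains I where "finite I" "g \<in> convex hull (y ` I)"
proof -
  obtain S u where S: "finite S" "S \<subseteq> range y" "\<forall>z\<in>S. 0 \<le> u z" "sum u S = 1" "(\<Sum>z\<in>S. u z *\<^sub>R z) = g"
    using assms unfolding convex_hull_explicit by blast
  then have "g \<in> convex hull S" unfolding convex_hull_explicit by blast
  moreover obtain I where "finite I" "S = y ` I" using finite_subset_image[OF S(1,2)] by blast
  ultimately show ?thesis using that by blast
qed

lemma convex_blinfun_ge:
  fixes b :: "'a::real_normed_vector \<Rightarrow>\<^sub>L real"
  shows "convex {z. c \<le> blinfun_apply b z}"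
proof -
  have "{z. c \<le> blinfun_apply b z} = blinfun_apply b -` {c..}" by auto
  then show ?thesis
    using convex_linear_vimage[of "blinfun_apply b" "{c..}"] convex_real_interval(1)[of c]
    by (simp add: bounded_linear.linear blinfun.bounded_linear_right)
qed

lemma boundary_norm: "is_boundary B \<Longrightarrow> b \<in> B \<Longrightarrow> norm b = 1"
  unfolding is_boundary_def by auto

lemma boundary_abs_le: "is_boundary B \<Longrightarrow> b \<in> B \<Longrightarrow> \<bar>blinfun_apply b z\<bar> \<le> norm z"
  using norm_blinfun[of b z] boundary_norm[of B b] by simp

lemma boundary_attains:
  assumes "is_boundary B"
  obtains b where "b \<in> B" "blinfun_apply b z = norm z"
  using assms unfolding is_boundary_def by blast

lemma boundary_nonempty: "is_boundary B \<Longrightarrow> B \<noteq> {}"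
  unfolding is_boundary_def by blast

lemma boundary_eval_bounded:
  assumes "is_boundary B" "\<forall>k. norm (x k) \<le> C"
  shows "\<forall>b\<in>B. \<forall>k. \<bar>blinfun_apply b (x k)\<bar> \<le> C"
proof (intro ballI allI)
  fix b k assume "b \<in> B"
  then have "\<bar>blinfun_apply b (x k)\<bar> \<le> norm (x k)" by (rule boundary_abs_le[OF assms(1)])
  then show "\<bar>blinfun_apply b (x k)\<bar> \<le> C" using assms(2) order_trans by blast
qed

context
  fixes B :: "('a::banach \<Rightarrow>\<^sub>L real) set" and x :: "nat \<Rightarrow> 'a" and C :: real
  assumes B: "is_boundary B" and C: "\<forall>k. norm (x k) \<le> C"
begin

text \<open>If \<open>b y - b z\<close> exceeded the oscillation, then \<open>b\<close> would have to take values near \<open>b y\<close> and near \<open>b z\<close> infinitely often. The bound is exact, which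
is the reason for working with intermediate points instead of the members of the sequence.\<close>

lemma intermediate_diff_le_osc:
  assumes "intermediate B x N y" "intermediate B x N z" "b \<in> B"
  shows "blinfun_apply b y - blinfun_apply b z \<le> osc B x N"
proof (rule ccontr)
  assume "\<not> ?thesis"
  then obtain d where d: "osc B x N < d" "d < blinfun_apply b y - blinfun_apply b z"
    using dense[of "osc B x N"] by (auto simp: not_le)
  define e where "e = (blinfun_apply b y - blinfun_apply b z - d) / 2"
  define r where "r = blinfun_apply b z + e"
  have e: "e > 0" "r + d < blinfun_apply b y" "blinfun_apply b z < r"
    using d(2) by (auto simp: e_def r_def field_simps)
  have "infinite {k\<in>N. blinfun_apply b (x k) < r}"
    using intermediate_ge[OF assms(2,3), of r] e by auto
  moreover have "{k\<in>N. blinfun_apply b (x k) < r} \<subseteq> {k\<in>N. blinfun_apply b (x k) \<le> r}" by auto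
  ultimately have "infinite {k\<in>N. blinfun_apply b (x k) \<le> r}" by (meson finite_subset)
  moreover have "infinite {k\<in>N. r + d \<le> blinfun_apply b (x k)}"
  proof -
    have "infinite {k\<in>N. r + d < blinfun_apply b (x k)}"
      using intermediate_le[OF assms(1,3), of "r + d"] e by auto
    moreover have "{k\<in>N. r + d < blinfun_apply b (x k)} \<subseteq> {k\<in>N. r + d \<le> blinfun_apply b (x k)}" by auto
    ultimately show ?thesis by (meson finite_subset)
  qed
  ultimately have "splits B x d N" using assms(3) unfolding splits_def by blast
  then have "d \<le> osc B x N" by (rule splits_le_osc[OF boundary_eval_bounded[OF B C] boundary_nonempty[OF B]])
  then show False using d(1) by simp
qed

text \<open>Shattering gives functionals with a prescribed finite pattern; here one functional realises the pattern on infinite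
subsets of \<open>S 0, \<dots>, S n\<close>. Simons' inequality is applied to averages \<open>y k\<close> of the differences \<open>x (i j k) - x (i n k)\<close>, \<open>j < n\<close>, where \<open>i j\<close>
enumerates \<open>S j\<close>. For the \<open>b\<close> obtained, infinitely many averages are close to the oscillation, which is also, up to an error, an upper bound for every single
difference. So all differences are close to it simultaneously.\<close>

lemma simultaneous_oscillation:
  fixes S :: "nat \<Rightarrow> nat set"
  assumes N: "infinite N"
    and sh: "\<forall>d<osc B x N. \<exists>F. finite F \<and> shatters B x d (N - F)"
    and n: "n > 0" and inf: "\<And>j. j \<le> n \<Longrightarrow> infinite (S j)"
    and sub: "\<And>j. j \<le> n \<Longrightarrow> S j \<subseteq> N" and disj: "disjoint_family_on S {..n}" and e: "e > 0"
  shows "\<exists>S'. (\<forall>j\<le>n. infinite (S' j) \<and> S' j \<subseteq> S j) \<and> (\<exists>b\<in>B. \<exists>r.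
     (\<forall>j<n. \<forall>k\<in>S' j. r + osc B x N - e \<le> blinfun_apply b (x k)) \<and>
     (\<forall>k\<in>S' n. blinfun_apply b (x k) \<le> r))"
proof -
  define \<delta> where "\<delta> = osc B x N"
  \<comment> \<open>The errors made below add up to at most \<open>(4 n + 1) \<epsilon>\<close>.\<close>
  define \<epsilon> where "\<epsilon> = e / (4 * real n + 1)"
  have \<epsilon>: "\<epsilon> > 0" "(4 * real n + 1) * \<epsilon> = e" using e by (auto simp: \<epsilon>_def)
  define d where "d = \<delta> - \<epsilon> / 2"
  obtain F where F: "finite F" "shatters B x d (N - F)"
    using sh[rule_format, of d] \<epsilon>(1) by (auto simp: d_def \<delta>_def)
  define i where "i = (\<lambda>j. enumerate (S j - F))"
  have i_in: "i j k \<in> S j - F" if "j \<le> n" for j k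
    unfolding i_def using inf[OF that] F(1) by (intro enumerate_in_set) simp
  have i_inj: "inj (i j)" if "j \<le> n" for j
    unfolding i_def using inf[OF that] F(1) by (intro strict_mono_imp_inj_on strict_mono_enumerate) simp
  define y where "y = (\<lambda>k. (1 / real n) *\<^sub>R (\<Sum>j<n. x (i j k)) - x (i n k))"
  have by_eq: "blinfun_apply b (y k) = (1 / real n) * (\<Sum>j<n. blinfun_apply b (x (i j k))) - blinfun_apply b (x (i n k))" for b k
    by (simp add: y_def blinfun.diff_right blinfun.scaleR_right blinfun.sum_right)
  have "norm (y k) \<le> 2 * C" for k
  proof -
    have "norm (\<Sum>j<n. x (i j k)) \<le> real n * C"
      using sum_norm_le[of "{..<n}" "\<lambda>j. x (i j k)" "\<lambda>_. C"] C by simp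
    then have "norm ((1 / real n) *\<^sub>R (\<Sum>j<n. x (i j k))) \<le> C"
      using n by (simp add: field_simps)
    then show ?thesis
      unfolding y_def using norm_triangle_ineq4[of "(1 / real n) *\<^sub>R (\<Sum>j<n. x (i j k))" "x (i n k)"] C[rule_format, of "i n k"] by linarith
  qed
  then have bdd: "bounded (range y)" by (auto simp: bounded_iff)
  have hull: "d \<le> norm g" if g: "g \<in> convex hull (range y)" for g
  proof -
    obtain I where I: "finite I" "g \<in> convex hull (y ` I)"
      using convex_hull_range_finite[OF g] by blast
    have "\<exists>b\<in>B. \<exists>r. (\<forall>k\<in>\<Union>j<n. i j ` I. r + d \<le> blinfun_apply b (x k)) \<and> (\<forall>k\<in>i n ` I. blinfun_apply b (x k) \<le> r)"
    proof (rule F(2)[unfolded shatters_def, rule_format])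
      have "i j k \<noteq> i n l" if "j < n" for j k l
      proof -
        have "S j \<inter> S n = {}" using disj that by (simp add: disjoint_family_on_def)
        then show ?thesis using i_in[of j k] i_in[of n l] that by auto
      qed
      then show "(\<Union>j<n. i j ` I) \<inter> i n ` I = {}" by blast
      have "i j k \<in> N - F" if "j \<le> n" for j k using i_in[OF that, of k] sub[OF that] by blast
      then show "(\<Union>j<n. i j ` I) \<subseteq> N - F" "i n ` I \<subseteq> N - F" by auto
    qed (use I(1) in auto)
    then obtain b r where b: "b \<in> B" and
        "\<forall>k\<in>\<Union>j<n. i j ` I. r + d \<le> blinfun_apply b (x k)" "\<forall>k\<in>i n ` I. blinfun_apply b (x k) \<le> r"
      by (elim bexE exE conjE)
    then have r: "\<And>j k. j < n \<Longrightarrow> k \<in> I \<Longrightarrow> r + d \<le> blinfun_apply b (x (i j k))"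
        "\<And>k. k \<in> I \<Longrightarrow> blinfun_apply b (x (i n k)) \<le> r"
      by auto
    have "d \<le> blinfun_apply b (y k)" if "k \<in> I" for k
    proof -
      have "real n * (r + d) \<le> (\<Sum>j<n. blinfun_apply b (x (i j k)))"
        using sum_bounded_below[of "{..<n}" "r + d" "\<lambda>j. blinfun_apply b (x (i j k))"] r(1)[OF _ that] by simp
      then have "r + d \<le> (1 / real n) * (\<Sum>j<n. blinfun_apply b (x (i j k)))"
        using n by (simp add: field_simps)
      then show ?thesis using r(2)[OF that] unfolding by_eq by linarith
    qed
    then have "convex hull (y ` I) \<subseteq> {z. d \<le> blinfun_apply b z}"
      by (intro hull_minimal convex_blinfun_ge) auto
    then have "d \<le> blinfun_apply b g" using I(2) by blast
    also have "\<dots> \<le> norm g" using boundary_abs_le[OF B b, of g] by simp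
    finally show ?thesis .
  qed
  have "\<epsilon> / 2 > 0" using \<epsilon>(1) by simp
  from simons_inequality[OF B bdd hull this]
  obtain b where b: "b \<in> B" "infinite {k. d - \<epsilon> / 2 < blinfun_apply b (y k)}" by blast
  define K0 where "K0 = {k. d - \<epsilon> / 2 < blinfun_apply b (y k)}"
  obtain r0 where r0: "finite {k\<in>N. blinfun_apply b (x k) < r0 \<or> r0 + \<delta> + \<epsilon> < blinfun_apply b (x k)}"
    using osc_range[OF boundary_eval_bounded[OF B C] boundary_nonempty[OF B] b(1) N \<epsilon>(1)] unfolding \<delta>_def by blast
  define E where "E = {k\<in>N. blinfun_apply b (x k) < r0 \<or> r0 + \<delta> + \<epsilon> < blinfun_apply b (x k)}"
  define K where "K = K0 - (\<Union>j\<le>n. i j -` E)"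
  have "finite E" using r0 by (simp add: E_def)
  then have "finite (\<Union>j\<le>n. i j -` E)"
    using i_inj by (auto intro!: finite_vimageI)
  then have infK: "infinite K" using b(2) by (simp add: K_def K0_def)
  have val: "r0 \<le> blinfun_apply b (x (i j k))" "blinfun_apply b (x (i j k)) \<le> r0 + \<delta> + \<epsilon>"
    if "k \<in> K" "j \<le> n" for j k
  proof -
    have "i j k \<notin> E" "i j k \<in> N" using that i_in[OF that(2), of k] sub[OF that(2)] by (auto simp: K_def)
    then show "r0 \<le> blinfun_apply b (x (i j k))" "blinfun_apply b (x (i j k)) \<le> r0 + \<delta> + \<epsilon>"
      by (auto simp: E_def)
  qed
  \<comment> \<open>The average of \<open>n\<close> numbers bounded by \<open>\<delta> + \<epsilon>\<close> exceeds \<open>\<delta> - \<epsilon>\<close>, so none of them is much smaller.\<close>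
  have gap: "\<delta> - 2 * real n * \<epsilon> \<le> blinfun_apply b (x (i j k)) - blinfun_apply b (x (i n k))"
    if k: "k \<in> K" and j: "j < n" for j k
  proof -
    define a where "a = (\<lambda>l. blinfun_apply b (x (i l k)) - blinfun_apply b (x (i n k)))"
    have a_le: "a l \<le> \<delta> + \<epsilon>" if "l < n" for l
      using val[OF k, of l] val[OF k, of n] that by (simp add: a_def)
    have "\<delta> - \<epsilon> < blinfun_apply b (y k)" using k by (simp add: K_def K0_def d_def)
    then have "real n * (\<delta> - \<epsilon>) \<le> real n * blinfun_apply b (y k)" by (intro mult_left_mono) auto
    also have "\<dots> = (\<Sum>l<n. a l)"
      using n by (simp add: by_eq a_def sum_subtractf field_simps)
    also have "\<dots> = a j + (\<Sum>l\<in>{..<n} - {j}. a l)"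
      using j by (simp add: sum.remove)
    also have "(\<Sum>l\<in>{..<n} - {j}. a l) \<le> (\<Sum>l\<in>{..<n} - {j}. \<delta> + \<epsilon>)"
      using a_le by (intro sum_mono) auto
    also have "\<dots> = (real n - 1) * (\<delta> + \<epsilon>)"
      using j n by (simp add: of_nat_diff)
    finally have "\<delta> - 2 * real n * \<epsilon> + \<epsilon> \<le> a j" by (simp add: algebra_simps)
    then show ?thesis using \<epsilon>(1) by (simp add: a_def)
  qed
  define r where "r = r0 + (2 * real n + 1) * \<epsilon>"
  have hi: "r + \<delta> - e \<le> blinfun_apply b (x (i j k))" if "k \<in> K" "j < n" for j k
    using gap[OF that] val(1)[OF that(1), of n] unfolding r_def \<epsilon>(2)[symmetric] by (simp add: algebra_simps)
  have lo: "blinfun_apply b (x (i n k)) \<le> r" if "k \<in> K" for k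
    using gap[OF that n] val(2)[OF that, of 0] unfolding r_def by (simp add: algebra_simps)
  show ?thesis
  proof (intro exI[of _ "\<lambda>j. i j ` K"] conjI)
    show "\<forall>j\<le>n. infinite (i j ` K) \<and> i j ` K \<subseteq> S j"
      using infK i_inj i_in by (auto dest!: finite_imageD intro: inj_on_subset)
    show "\<exists>b\<in>B. \<exists>r. (\<forall>j<n. \<forall>k\<in>i j ` K. r + osc B x N - e \<le> blinfun_apply b (x k)) \<and>
        (\<forall>k\<in>i n ` K. blinfun_apply b (x k) \<le> r)"
      using b(1) hi lo unfolding \<delta>_def by blast
  qed
qed

text \<open>At stage \<open>m\<close> the sets \<open>T 0, \<dots>, T (m - 1)\<close> have been separated from a common reservoir, which is recorded as
\<open>T j\<close> for all \<open>j \<ge> m\<close>. The reservoir is split in two, and \<open>simultaneous_oscillation\<close> shrinks the sets so that a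
functional is high on the first \<open>m + 1\<close> of them and low on what remains of the reservoir. The set \<open>U j\<close> is a pseudo-intersection of
the successive versions of \<open>T j\<close>.\<close>

lemma triangular_array:
  assumes N: "infinite N"
    and sh: "\<forall>d<osc B x N. \<exists>F. finite F \<and> shatters B x d (N - F)"
  shows "\<exists>U. (\<forall>j::nat. infinite (U j) \<and> finite (U j - N)) \<and> (\<forall>m. \<exists>b\<in>B. \<exists>r.
     (\<forall>j\<le>m. finite {k\<in>U j. blinfun_apply b (x k) < r + osc B x N - inverse (real (Suc m))}) \<and>
     (\<forall>j>m. finite {k\<in>U j. r < blinfun_apply b (x k)}))"
proof -
  define P where "P = (\<lambda>m (T::nat \<Rightarrow> nat set). (\<forall>j. infinite (T j) \<and> T j \<subseteq> N) \<and>
      disjoint_family_on T {..m} \<and> (\<forall>j\<ge>m. T j = T m))"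
  define Q where "Q = (\<lambda>m (T::nat \<Rightarrow> nat set) T'. (\<forall>j. T' j \<subseteq> T j) \<and> (\<exists>b\<in>B. \<exists>r.
     (\<forall>j\<le>m. \<forall>k\<in>T' j. r + osc B x N - inverse (real (Suc m)) \<le> blinfun_apply b (x k)) \<and>
     (\<forall>j>m. \<forall>k\<in>T' j. blinfun_apply b (x k) \<le> r)))"
  have "\<exists>T. \<forall>m. P m (T m) \<and> Q m (T m) (T (Suc m))"
  proof (rule dependent_nat_choice)
    show "\<exists>T. P 0 T" using N by (intro exI[of _ "\<lambda>_. N"]) (auto simp: P_def disjoint_family_on_def)
    fix T m assume "P m T"
    then have T: "\<And>j. infinite (T j)" "\<And>j. T j \<subseteq> N" "disjoint_family_on T {..m}" "\<And>j. j \<ge> m \<Longrightarrow> T j = T m"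
      unfolding P_def by blast+
    obtain A1 A2 where A: "A1 \<subseteq> T m" "A2 \<subseteq> T m" "infinite A1" "infinite A2" "A1 \<inter> A2 = {}"
      using split_infinite_nat_set[OF T(1)] by blast
    define S where "S = (\<lambda>j. if j < m then T j else if j = m then A1 else A2)"
    have S: "S j \<subseteq> T j" for j
      using A T(4)[of j] by (cases "j < m") (auto simp: S_def)
    have "disjoint_family_on S {..Suc m}"
      unfolding disjoint_family_on_def
    proof (intro ballI impI)
      fix i j assume ij: "i \<in> {..Suc m}" "j \<in> {..Suc m}" "i \<noteq> j"
      have disjT: "T i \<inter> T j = {}" if "i \<le> m" "j \<le> m" "i \<noteq> j" for i j
        using T(3) that by (auto simp: disjoint_family_on_def)
      have "S i \<inter> S j = {}" if "i < j" "j \<le> Suc m" for i j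
      proof (cases "i = m")
        case True
        then show ?thesis using that A(5) by (simp add: S_def)
      next
        case False
        then have "i < m" using that by simp
        then have "T i \<inter> T (min j m) = {}" using disjT[of i "min j m"] that by auto
        moreover have "S j \<subseteq> T (min j m)" using S[of j] T(4)[of j] by (cases "j \<le> m") (auto simp: min_def)
        ultimately show ?thesis using S[of i] by blast
      qed
      then show "S i \<inter> S j = {}" using ij by (metis Int_commute atMost_iff linorder_neqE_nat)
    qed
    moreover have "infinite (S j)" "S j \<subseteq> N" for j
      using T(1) A(3,4) S[of j] T(2)[of j] by (auto simp: S_def)
    ultimately have "\<exists>S'. (\<forall>j\<le>Suc m. infinite (S' j) \<and> S' j \<subseteq> S j) \<and> (\<exists>b\<in>B. \<exists>r.
     (\<forall>j<Suc m. \<forall>k\<in>S' j. r + osc B x N - inverse (real (Suc m)) \<le> blinfun_apply b (x k)) \<and>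
     (\<forall>k\<in>S' (Suc m). blinfun_apply b (x k) \<le> r))"
      by (intro simultaneous_oscillation[OF N sh]) auto
    then obtain S' b r where S': "\<And>j. j \<le> Suc m \<Longrightarrow> infinite (S' j)" "\<And>j. j \<le> Suc m \<Longrightarrow> S' j \<subseteq> S j"
      and b: "b \<in> B" "\<And>j k. j \<le> m \<Longrightarrow> k \<in> S' j \<Longrightarrow> r + osc B x N - inverse (real (Suc m)) \<le> blinfun_apply b (x k)"
        "\<And>k. k \<in> S' (Suc m) \<Longrightarrow> blinfun_apply b (x k) \<le> r"
      by (metis le_imp_less_Suc)
    \<comment> \<open>The set \<open>S' (Suc m)\<close> is the new reservoir and is repeated for all later indices.\<close>
    define T' where "T' = (\<lambda>j. S' (min j (Suc m)))"
    have T'T: "T' j \<subseteq> T j" for j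
    proof (cases "j \<le> m")
      case True
      then show ?thesis using S'(2)[of j] S[of j] by (simp add: T'_def min_def)
    next
      case False
      then have "T' j = S' (Suc m)" "T j = T (Suc m)"
        using T(4)[of j] T(4)[of "Suc m"] by (auto simp: T'_def min_def le_Suc_eq)
      then show ?thesis using S'(2)[of "Suc m"] S[of "Suc m"] by simp
    qed
    have "P (Suc m) T'"
      unfolding P_def
    proof (intro conjI)
      show "\<forall>j. infinite (T' j) \<and> T' j \<subseteq> N" using S'(1) T'T T(2) by (fastforce simp: T'_def)
      show "disjoint_family_on T' {..Suc m}"
        unfolding disjoint_family_on_def
      proof (intro ballI impI)
        fix i j assume ij: "i \<in> {..Suc m}" "j \<in> {..Suc m}" "i \<noteq> j"
        have "S i \<inter> S j = {}" using \<open>disjoint_family_on S {..Suc m}\<close> ij by (simp add: disjoint_family_on_def)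
        moreover have "T' i \<subseteq> S i" "T' j \<subseteq> S j" using ij S'(2) by (auto simp: T'_def)
        ultimately show "T' i \<inter> T' j = {}" by blast
      qed
      show "\<forall>j\<ge>Suc m. T' j = T' (Suc m)" by (auto simp: T'_def min_def)
    qed
    moreover have "Q m T T'"
      unfolding Q_def using T'T b by (intro conjI allI bexI[of _ b] exI[of _ r]) (auto simp: T'_def min_def le_Suc_eq)
    ultimately show "\<exists>T'. P (Suc m) T' \<and> Q m T T'" by blast
  qed
  then obtain T where T: "\<And>m. P m (T m)" "\<And>m. Q m (T m) (T (Suc m))" by blast
  have "\<exists>U. infinite U \<and> (\<forall>m. finite (U - T m j))" for j
  proof (rule pseudo_intersection)
    show "infinite (T m j)" for m using T(1)[of m] by (simp add: P_def)
    show "T (Suc m) j \<subseteq> T m j" for m using T(2)[of m] by (simp add: Q_def)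
  qed
  then obtain U where U: "\<And>j. infinite (U j)" "\<And>j m. finite (U j - T m j)" by metis
  show ?thesis
  proof (intro exI[of _ U] conjI allI)
    show "infinite (U j)" for j by (rule U(1))
    show "finite (U j - N)" for j
      by (rule finite_subset[OF _ U(2)[of j 0]]) (use T(1)[of 0] in \<open>auto simp: P_def\<close>)
    fix m
    obtain b r where b: "b \<in> B"
        "\<And>j k. j \<le> m \<Longrightarrow> k \<in> T (Suc m) j \<Longrightarrow> r + osc B x N - inverse (real (Suc m)) \<le> blinfun_apply b (x k)"
        "\<And>j k. j > m \<Longrightarrow> k \<in> T (Suc m) j \<Longrightarrow> blinfun_apply b (x k) \<le> r"
      using T(2)[of m] unfolding Q_def by blast
    show "\<exists>b\<in>B. \<exists>r. (\<forall>j\<le>m. finite {k\<in>U j. blinfun_apply b (x k) < r + osc B x N - inverse (real (Suc m))}) \<and>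
       (\<forall>j>m. finite {k\<in>U j. r < blinfun_apply b (x k)})"
    proof (intro bexI[OF _ b(1)] exI[of _ r] conjI allI impI)
      show "finite {k\<in>U j. blinfun_apply b (x k) < r + osc B x N - inverse (real (Suc m))}" if "j \<le> m" for j
      proof (rule finite_subset[OF _ U(2)[of j "Suc m"]], rule subsetI)
        fix k assume k: "k \<in> {k\<in>U j. blinfun_apply b (x k) < r + osc B x N - inverse (real (Suc m))}"
        then show "k \<in> U j - T (Suc m) j" using b(2)[OF that, of k] by auto
      qed
      show "finite {k\<in>U j. r < blinfun_apply b (x k)}" if "m < j" for j
      proof (rule finite_subset[OF _ U(2)[of j "Suc m"]], rule subsetI)
        fix k assume k: "k \<in> {k\<in>U j. r < blinfun_apply b (x k)}"
        then show "k \<in> U j - T (Suc m) j" using b(3)[OF that, of k] by auto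
      qed
    qed
  qed
qed

end

section \<open>Stable sequences do not oscillate\<close>

text \<open>The exceptional finite sets \<open>F\<close> make the condition stable under almost inclusion, so that all gaps below \<open>\<delta>\<close> can be
treated in one diagonal argument.\<close>

lemma shattered_subset:
  assumes N: "infinite N" and stable: "\<forall>N'\<subseteq>N. infinite N' \<longrightarrow> (\<forall>d<\<delta>. splits B x d N')"
  shows "\<exists>M\<subseteq>N. infinite M \<and> (\<forall>d<\<delta>. \<exists>F. finite F \<and> shatters B x d (M - F))"
proof -
  \<comment> \<open>The second alternative makes the condition attainable below an arbitrary infinite set, not only below \<open>N\<close>; it does not occur for infinite subsets of \<open>N\<close>.\<close>
  define P where "P = (\<lambda>n K. (\<exists>F. finite F \<and> shatters B x (\<delta> - inverse (real (Suc n))) (K - F)) \<or> finite (K \<inter> N))"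
  have "\<exists>M\<subseteq>N. infinite M \<and> (\<forall>n. P n M)"
  proof (rule diagonal_subset)
    fix n and K :: "nat set" assume K: "infinite K"
    show "\<exists>K'\<subseteq>K. infinite K' \<and> P n K'"
    proof (cases "finite (K \<inter> N)")
      case True
      then show ?thesis using K by (intro exI[of _ K]) (auto simp: P_def)
    next
      case False
      have "\<forall>L\<subseteq>K \<inter> N. infinite L \<longrightarrow> splits B x (\<delta> - inverse (real (Suc n))) L"
        using stable by simp
      from splits_imp_shatters[OF False this] obtain L where
        L: "L \<subseteq> K \<inter> N" "infinite L" "shatters B x (\<delta> - inverse (real (Suc n))) L" by metis
      then have "P n L" unfolding P_def by (intro disjI1 exI[of _ "{}"]) simp
      then show ?thesis using L by blast
    qed
  next
    fix n and K K' :: "nat set" assume *: "P n K" "infinite K'" "finite (K' - K)"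
    show "P n K'"
    proof (cases "finite (K \<inter> N)")
      case True
      have "K' \<inter> N \<subseteq> (K \<inter> N) \<union> (K' - K)" by auto
      then show ?thesis using True *(3) finite_subset unfolding P_def by blast
    next
      case False
      then obtain F where F: "finite F" "shatters B x (\<delta> - inverse (real (Suc n))) (K - F)"
        using *(1) unfolding P_def by blast
      have "K' - (F \<union> (K' - K)) \<subseteq> K - F" by auto
      then have "shatters B x (\<delta> - inverse (real (Suc n))) (K' - (F \<union> (K' - K)))"
        by (rule shatters_subset[OF F(2)])
      then show ?thesis unfolding P_def using F(1) *(3) by (intro disjI1 exI[of _ "F \<union> (K' - K)"]) simp
    qed
  qed (rule N)
  then obtain M where M: "M \<subseteq> N" "infinite M" "\<And>n. P n M" by metis
  have "\<exists>F. finite F \<and> shatters B x d (M - F)" if "d < \<delta>" for d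
  proof -
    obtain n where n: "inverse (real (Suc n)) < \<delta> - d" using reals_Archimedean[of "\<delta> - d"] \<open>d < \<delta>\<close> by auto
    have "M \<inter> N = M" using M(1) by auto
    then obtain F where F: "finite F" "shatters B x (\<delta> - inverse (real (Suc n))) (M - F)"
      using M(2) M(3)[of n] unfolding P_def by auto
    have "shatters B x d (M - F)" by (rule shatters_antimono[OF F(2)]) (use n in simp)
    then show ?thesis using F(1) by blast
  qed
  then show ?thesis using M by blast
qed

context
  fixes B :: "('a::banach \<Rightarrow>\<^sub>L real) set" and A :: "'a set"
  assumes B: "is_boundary B" and A: "bounded A"
    and cl: "\<forall>x. range x \<subseteq> A \<longrightarrow> (\<exists>y\<in>A. intermediate B x UNIV y)"
begin

lemma intermediate_exists:
  fixes x :: "nat \<Rightarrow> 'a"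
  assumes "range x \<subseteq> A" "infinite N"
  shows "\<exists>y\<in>A. intermediate B x N y"
proof -
  have "range (x \<circ> enumerate N) \<subseteq> A" using assms(1) by auto
  then obtain y where "y \<in> A" "intermediate B (x \<circ> enumerate N) UNIV y" using cl by blast
  then show ?thesis using intermediate_enumerate[OF _ assms(2)] by blast
qed

text \<open>The heart of the proof: the norm of \<open>G = \<Sum>\<^sub>j s j (u j - v)\<close> is at least \<open>\<delta>\<close> by the triangular array, no \<open>b \<in> B\<close> exceeds \<open>\<delta>\<close> on any
\<open>u j - v\<close>, and the weights \<open>s j\<close> sum to 1. A norm-attaining \<open>b\<close> is thus equal to \<open>\<delta>\<close> on each \<open>u j - v\<close>, contrary to the choice of \<open>v\<close> as
an intermediate point of \<open>(u j)\<close>.\<close>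

lemma stable_osc_nonpos:
  assumes x: "range x \<subseteq> A" and N: "infinite N"
    and stable: "\<And>N'. N' \<subseteq> N \<Longrightarrow> infinite N' \<Longrightarrow> osc B x N' = osc B x N"
  shows "osc B x N \<le> 0"
proof (rule ccontr)
  assume "\<not> osc B x N \<le> 0"
  define \<delta> where "\<delta> = osc B x N"
  have pos: "\<delta> > 0" using \<open>\<not> osc B x N \<le> 0\<close> by (simp add: \<delta>_def)
  obtain C where "\<forall>a\<in>A. norm a \<le> C" using A by (auto simp: bounded_iff)
  then have C: "\<forall>k. norm (x k) \<le> C" using x by auto
  have "\<forall>N'\<subseteq>N. infinite N' \<longrightarrow> (\<forall>d<\<delta>. splits B x d N')"
    using less_osc_splits[OF boundary_eval_bounded[OF B C] boundary_nonempty[OF B]] stable by (simp add: \<delta>_def)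
  from shattered_subset[OF N this] obtain M where M: "M \<subseteq> N" "infinite M"
    and sh: "\<forall>d<\<delta>. \<exists>F. finite F \<and> shatters B x d (M - F)" by metis
  have oscM: "osc B x M = \<delta>" using stable[OF M] by (simp add: \<delta>_def)
  obtain U :: "nat \<Rightarrow> nat set" where U': "\<forall>j. infinite (U j) \<and> finite (U j - M)"
    and tri: "\<forall>m. \<exists>b\<in>B. \<exists>r.
     (\<forall>j\<le>m. finite {k\<in>U j. blinfun_apply b (x k) < r + \<delta> - inverse (real (Suc m))}) \<and>
     (\<forall>j>m. finite {k\<in>U j. r < blinfun_apply b (x k)})"
    using triangular_array[OF B C M(2), unfolded oscM, OF sh] by (elim exE conjE)
  have U: "infinite (U j)" "finite (U j - M)" for j using U' by auto
  have "\<exists>y\<in>A. intermediate B x (U j) y" for j by (rule intermediate_exists[OF x U(1)])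
  then obtain u where u: "\<And>j. u j \<in> A" "\<And>j. intermediate B x (U j) (u j)" by metis
  have "range u \<subseteq> A" using u(1) by auto
  then obtain v where v: "v \<in> A" "intermediate B u UNIV v" using cl by blast
  have uM: "intermediate B x M (u j)" for j by (rule intermediate_almost_superset[OF u(2) U(2)])
  have vM: "intermediate B x M v"
    unfolding intermediate_def
  proof (intro ballI allI conjI impI)
    fix b c assume b: "b \<in> B"
    show "blinfun_apply b v \<le> c" if "finite {k\<in>M. c < blinfun_apply b (x k)}"
    proof (rule intermediate_le[OF v(2) b])
      have "{j. c < blinfun_apply b (u j)} = {}" using intermediate_le[OF uM b that] by (auto simp: not_less)
      then show "finite {j\<in>UNIV. c < blinfun_apply b (u j)}" by simp
    qed
    show "c \<le> blinfun_apply b v" if "finite {k\<in>M. blinfun_apply b (x k) < c}"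
    proof (rule intermediate_ge[OF v(2) b])
      have "{j. blinfun_apply b (u j) < c} = {}" using intermediate_ge[OF uM b that] by (auto simp: not_less)
      then show "finite {j\<in>UNIV. blinfun_apply b (u j) < c}" by simp
    qed
  qed
  have le: "blinfun_apply b (u j - v) \<le> \<delta>" if "b \<in> B" for b j
    using intermediate_diff_le_osc[OF B C uM vM that] by (simp add: oscM blinfun.diff_right)
  define s :: "nat \<Rightarrow> real" where "s = (\<lambda>j. (1/2) ^ Suc j)"
  have s_pos: "s j > 0" for j by (simp add: s_def)
  have s_sums: "s sums 1" unfolding s_def by (rule power_half_series)
  have norm_le: "norm (u j - v) \<le> \<delta>" for j
    using boundary_attains[OF B, of "u j - v"] le by metis
  define G where "G = (\<Sum>j. s j *\<^sub>R (u j - v))"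
  have summ: "summable (\<lambda>j. s j *\<^sub>R (u j - v))"
  proof (rule summable_comparison_test')
    show "summable (\<lambda>j. s j * \<delta>)" using s_sums by (intro summable_mult2) (rule sums_summable)
    show "norm (s j *\<^sub>R (u j - v)) \<le> s j * \<delta>" for j
      using norm_le[of j] s_pos[of j] by (simp add: mult_left_mono)
  qed
  then have G_sums: "(\<lambda>j. s j *\<^sub>R (u j - v)) sums G" unfolding G_def by (rule summable_sums)
  have G_ge: "\<delta> \<le> norm G"
  proof -
    define G' where "G' = (\<lambda>m. \<Sum>j<Suc m. s j *\<^sub>R (u j - v))"
    define \<sigma> where "\<sigma> = (\<lambda>m. \<Sum>j<Suc m. s j)"
    have G'_lim: "G' \<longlonglongrightarrow> G" unfolding G'_def using G_sums[unfolded sums_def] by (rule LIMSEQ_Suc)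
    have \<sigma>_lim: "\<sigma> \<longlonglongrightarrow> 1" unfolding \<sigma>_def using s_sums[unfolded sums_def] by (rule LIMSEQ_Suc)
    have "(\<delta> - inverse (real (Suc m))) * \<sigma> m - norm (G' m - G) \<le> norm G" for m
    proof -
      obtain b r where b: "b \<in> B" and
        hi: "\<forall>j\<le>m. finite {k\<in>U j. blinfun_apply b (x k) < r + \<delta> - inverse (real (Suc m))}" and
        lo: "\<forall>j>m. finite {k\<in>U j. r < blinfun_apply b (x k)}"
        using tri[THEN spec, of m] by (elim bexE exE conjE)
      have "{j. r < blinfun_apply b (u j)} \<subseteq> {..m}"
      proof
        fix j assume "j \<in> {j. r < blinfun_apply b (u j)}"
        then have "\<not> m < j" using intermediate_le[OF u(2)[of j] b, of r] lo by force
        then show "j \<in> {..m}" by simp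
      qed
      then have "finite {j\<in>UNIV. r < blinfun_apply b (u j)}" by (simp add: finite_subset)
      then have bv: "blinfun_apply b v \<le> r" by (rule intermediate_le[OF v(2) b])
      have "\<delta> - inverse (real (Suc m)) \<le> blinfun_apply b (u j - v)" if "j \<le> m" for j
        using intermediate_ge[OF u(2) b hi[rule_format, OF that]] bv by (simp add: blinfun.diff_right)
      then have "(\<Sum>j<Suc m. s j * (\<delta> - inverse (real (Suc m)))) \<le> (\<Sum>j<Suc m. s j * blinfun_apply b (u j - v))"
        by (intro sum_mono mult_left_mono less_imp_le[OF s_pos]) auto
      then have "(\<delta> - inverse (real (Suc m))) * \<sigma> m \<le> blinfun_apply b (G' m)"
        by (simp add: \<sigma>_def G'_def blinfun.sum_right blinfun.scaleR_right sum_distrib_right mult.commute del: sum.lessThan_Suc)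
      also have "\<dots> \<le> norm (G' m)" using boundary_abs_le[OF B b, of "G' m"] by simp
      also have "\<dots> \<le> norm (G' m - G) + norm G" using norm_triangle_sub[of "G' m" G] by simp
      finally show ?thesis by simp
    qed
    then have "\<exists>n. \<forall>m\<ge>n. (\<delta> - inverse (real (Suc m))) * \<sigma> m - norm (G' m - G) \<le> norm G" by blast
    moreover have "(\<lambda>m. (\<delta> - inverse (real (Suc m))) * \<sigma> m - norm (G' m - G)) \<longlonglongrightarrow> (\<delta> - 0) * 1 - norm (G - G)"
      by (intro tendsto_intros \<sigma>_lim G'_lim LIMSEQ_inverse_real_of_nat)
    ultimately have "(\<delta> - 0) * 1 - norm (G - G) \<le> norm G" by (intro LIMSEQ_le_const2)
    then show ?thesis by simp
  qed
  obtain b where b: "b \<in> B" "blinfun_apply b G = norm G" using boundary_attains[OF B] by metis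
  have b_sums: "(\<lambda>j. s j * (\<delta> - blinfun_apply b (u j - v))) sums (\<delta> - norm G)"
  proof -
    have "(\<lambda>j. blinfun_apply b (s j *\<^sub>R (u j - v))) sums norm G"
      using bounded_linear.sums[OF blinfun.bounded_linear_right G_sums] b(2) by metis
    from sums_diff[OF sums_mult2[OF s_sums, of \<delta>] this] show ?thesis
      by (simp add: blinfun.scaleR_right right_diff_distrib)
  qed
  have "blinfun_apply b (u j - v) = \<delta>" for j
  proof (rule ccontr)
    assume "\<not> ?thesis"
    then have "s j * (\<delta> - blinfun_apply b (u j - v)) > 0" using le[OF b(1), of j] s_pos by simp
    moreover have "s i * (\<delta> - blinfun_apply b (u i - v)) \<ge> 0" for i
      using le[OF b(1), of i] s_pos[of i] by simp
    ultimately have "\<delta> - norm G > 0"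
      using suminf_pos2[OF sums_summable[OF b_sums]] sums_unique[OF b_sums] by metis
    then show False using G_ge by simp
  qed
  then have "{j\<in>UNIV. blinfun_apply b (u j) < blinfun_apply b v + \<delta>} = {}"
    by (auto simp: blinfun.diff_right not_less algebra_simps)
  then have "blinfun_apply b v + \<delta> \<le> blinfun_apply b v"
    by (intro intermediate_ge[OF v(2) b(1)]) simp
  then show False using pos by simp
qed

text \<open>Along a stable set of indices no element of \<open>B\<close> oscillates by a positive amount, and an intermediate point is then a limit.\<close>

lemma sigma_convergent_subsequence:
  fixes x :: "nat \<Rightarrow> 'a"
  assumes x: "range x \<subseteq> A"
  shows "\<exists>r y. strict_mono r \<and> y \<in> A \<and> (\<forall>b\<in>B. (\<lambda>i. blinfun_apply b (x (r i))) \<longlonglongrightarrow> blinfun_apply b y)"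
proof -
  obtain C where "\<forall>a\<in>A. norm a \<le> C" using A by (auto simp: bounded_iff)
  then have C: "\<forall>k. norm (x k) \<le> C" using x by auto
  obtain N where N: "infinite N" "\<And>N'. N' \<subseteq> N \<Longrightarrow> infinite N' \<Longrightarrow> osc B x N' = osc B x N"
    using osc_stable_subset[OF boundary_eval_bounded[OF B C] boundary_nonempty[OF B] infinite_UNIV_nat] by metis
  have nonpos: "osc B x N \<le> 0" by (rule stable_osc_nonpos[OF x N])
  obtain y where y: "y \<in> A" "intermediate B x N y" using intermediate_exists[OF x N(1)] by blast
  have not_split: "\<not> splits B x d N" if "d > 0" for d
    using splits_le_osc[OF boundary_eval_bounded[OF B C] boundary_nonempty[OF B], of d N] nonpos that by auto
  define e where "e = enumerate N"
  have e: "strict_mono e" "\<And>i. e i \<in> N"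
    unfolding e_def using N(1) by (rule strict_mono_enumerate, intro enumerate_in_set)
  have "(\<lambda>i. blinfun_apply b (x (e i))) \<longlonglongrightarrow> blinfun_apply b y" if b: "b \<in> B" for b
  proof (rule LIMSEQ_I)
    fix \<epsilon> :: real assume "\<epsilon> > 0"
    define z where "z = blinfun_apply b y"
    have up: "finite {k\<in>N. z + \<epsilon> \<le> blinfun_apply b (x k)}"
    proof (rule ccontr)
      assume inf: "infinite {k\<in>N. z + \<epsilon> \<le> blinfun_apply b (x k)}"
      have "infinite {k\<in>N. blinfun_apply b (x k) < z + \<epsilon> / 2}"
        using intermediate_ge[OF y(2) b, of "z + \<epsilon> / 2"] \<open>\<epsilon> > 0\<close> by (auto simp: z_def)
      moreover have "{k\<in>N. blinfun_apply b (x k) < z + \<epsilon> / 2} \<subseteq> {k\<in>N. blinfun_apply b (x k) \<le> z + \<epsilon> / 2}" by auto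
      ultimately have "infinite {k\<in>N. blinfun_apply b (x k) \<le> z + \<epsilon> / 2}" by (meson finite_subset)
      moreover have "infinite {k\<in>N. (z + \<epsilon> / 2) + \<epsilon> / 2 \<le> blinfun_apply b (x k)}" using inf by (simp add: add.assoc)
      ultimately have "splits B x (\<epsilon> / 2) N" using b unfolding splits_def by blast
      then show False using not_split \<open>\<epsilon> > 0\<close> by simp
    qed
    have down: "finite {k\<in>N. blinfun_apply b (x k) \<le> z - \<epsilon>}"
    proof (rule ccontr)
      assume inf: "infinite {k\<in>N. blinfun_apply b (x k) \<le> z - \<epsilon>}"
      have "infinite {k\<in>N. z - \<epsilon> / 2 < blinfun_apply b (x k)}"
        using intermediate_le[OF y(2) b, of "z - \<epsilon> / 2"] \<open>\<epsilon> > 0\<close> by (auto simp: z_def)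
      moreover have "{k\<in>N. z - \<epsilon> / 2 < blinfun_apply b (x k)} \<subseteq> {k\<in>N. z - \<epsilon> + \<epsilon> / 2 \<le> blinfun_apply b (x k)}" by auto
      ultimately have "infinite {k\<in>N. z - \<epsilon> + \<epsilon> / 2 \<le> blinfun_apply b (x k)}" by (meson finite_subset)
      then have "splits B x (\<epsilon> / 2) N" using inf b unfolding splits_def by blast
      then show False using not_split \<open>\<epsilon> > 0\<close> by simp
    qed
    define E where "E = {k\<in>N. z + \<epsilon> \<le> blinfun_apply b (x k)} \<union> {k\<in>N. blinfun_apply b (x k) \<le> z - \<epsilon>}"
    have "finite (e -` E)"
      using up down strict_mono_imp_inj_on[OF e(1)] by (intro finite_vimageI) (auto simp: E_def)
    then obtain n where "e -` E \<subseteq> {..<n}" using finite_nat_bounded by blast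
    then have n: "\<And>i. i \<in> e -` E \<Longrightarrow> i < n" by blast
    have "norm (blinfun_apply b (x (e i)) - blinfun_apply b y) < \<epsilon>" if "i \<ge> n" for i
    proof -
      have "e i \<notin> E" using n[of i] that by auto
      then have "blinfun_apply b (x (e i)) < z + \<epsilon>" "z - \<epsilon> < blinfun_apply b (x (e i))"
        using e(2)[of i] by (auto simp: E_def)
      then show ?thesis by (simp add: z_def abs_less_iff)
    qed
    then show "\<exists>n. \<forall>i\<ge>n. norm (blinfun_apply b (x (e i)) - blinfun_apply b y) < \<epsilon>" by blast
  qed
  then show ?thesis using e(1) y(1) by blast
qed

end

section \<open>From convergence on the boundary to weak convergence\<close>

text \<open>Mazur's lemma for pointwise convergence on a boundary: if the hull of the sequence stayed away from \<open>y\<close>, Simons' inequality for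
\<open>x i - y\<close> would give an element of \<open>B\<close> along which the sequence does not converge to \<open>y\<close>.\<close>

lemma boundary_mazur:
  fixes B :: "('a::banach \<Rightarrow>\<^sub>L real) set" and x :: "nat \<Rightarrow> 'a"
  assumes B: "is_boundary B" and bdd: "bounded (range x)"
    and lim: "\<And>b. b \<in> B \<Longrightarrow> (\<lambda>i. blinfun_apply b (x i)) \<longlonglongrightarrow> blinfun_apply b y" and e: "\<epsilon> > 0"
  shows "\<exists>z\<in>convex hull (range x). norm (z - y) < \<epsilon>"
proof (rule ccontr)
  assume "\<not> ?thesis"
  then have far: "\<And>z. z \<in> convex hull (range x) \<Longrightarrow> \<epsilon> \<le> norm (z - y)" by (auto simp: not_less)
  define w where "w = (\<lambda>i. - y + x i)"
  have w: "range w = (\<lambda>v. - y + v) ` range x" by (auto simp: w_def)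
  have bw: "bounded (range w)" unfolding w by (rule bounded_translation[OF bdd])
  have "\<epsilon> \<le> norm g" if "g \<in> convex hull (range w)" for g
    using that far unfolding w convex_hull_translation by auto
  from simons_inequality[OF B bw this, of "\<epsilon> / 2"] e
  obtain b where b: "b \<in> B" "infinite {k. \<epsilon> - \<epsilon> / 2 < blinfun_apply b (w k)}" by auto
  have "\<forall>\<^sub>F i in sequentially. blinfun_apply b (x i) < blinfun_apply b y + \<epsilon> / 2"
    using lim[OF b(1)] e by (intro order_tendstoD) auto
  then have "\<forall>\<^sub>F i in cofinite. \<not> (\<epsilon> - \<epsilon> / 2 < blinfun_apply b (w i))"
    unfolding cofinite_eq_sequentially
    by eventually_elim (simp add: w_def blinfun.diff_right)
  then show False using b(2) by (simp add: eventually_cofinite)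
qed

text \<open>If \<open>f (x i)\<close> failed to converge to \<open>f y\<close>, then \<open>f\<close> or \<open>- f\<close> would separate \<open>y\<close> strictly from the hull of a subsequence,
against \<open>boundary_mazur\<close>.\<close>

lemma rainwater_simons:
  fixes B :: "('a::banach \<Rightarrow>\<^sub>L real) set" and x :: "nat \<Rightarrow> 'a" and f :: "'a \<Rightarrow>\<^sub>L real"
  assumes B: "is_boundary B" and bdd: "bounded (range x)"
    and lim: "\<And>b. b \<in> B \<Longrightarrow> (\<lambda>i. blinfun_apply b (x i)) \<longlonglongrightarrow> blinfun_apply b y"
  shows "(\<lambda>i. blinfun_apply f (x i)) \<longlonglongrightarrow> blinfun_apply f y"
proof -
  have key: "finite {i. \<epsilon> \<le> blinfun_apply g (x i - y)}" if "\<epsilon> > 0" for \<epsilon> and g :: "'a \<Rightarrow>\<^sub>L real"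
  proof (rule ccontr)
    assume inf: "infinite {i. \<epsilon> \<le> blinfun_apply g (x i - y)}"
    define e where "e = enumerate {i. \<epsilon> \<le> blinfun_apply g (x i - y)}"
    have e: "strict_mono e" "\<And>i. \<epsilon> \<le> blinfun_apply g (x (e i) - y)"
      unfolding e_def using strict_mono_enumerate[OF inf] enumerate_in_set[OF inf] by auto
    have be: "bounded (range (x \<circ> e))" by (rule bounded_subset[OF bdd]) auto
    have lime: "(\<lambda>i. blinfun_apply b ((x \<circ> e) i)) \<longlonglongrightarrow> blinfun_apply b y" if "b \<in> B" for b
      using LIMSEQ_subseq_LIMSEQ[OF lim[OF that] e(1)] by (simp add: o_def)
    have "\<epsilon> / (norm g + 1) > 0" using \<open>\<epsilon> > 0\<close> by (simp add: add_nonneg_pos)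
    then obtain z where z: "z \<in> convex hull (range (x \<circ> e))" "norm (z - y) < \<epsilon> / (norm g + 1)"
      using boundary_mazur[OF B be lime] by blast
    have "convex hull (range (x \<circ> e)) \<subseteq> {w. blinfun_apply g y + \<epsilon> \<le> blinfun_apply g w}"
      using e(2) by (intro hull_minimal convex_blinfun_ge) (auto simp: blinfun.diff_right algebra_simps)
    then have "\<epsilon> \<le> blinfun_apply g (z - y)" using z(1) by (auto simp: blinfun.diff_right)
    also have "\<dots> \<le> norm g * norm (z - y)" using norm_blinfun[of g "z - y"] by simp
    also have "\<dots> \<le> (norm g + 1) * norm (z - y)" by (intro mult_right_mono) auto
    also have "\<dots> < \<epsilon>"
      using z(2) by (simp add: pos_less_divide_eq add_nonneg_pos mult.commute)
    finally show False by simp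
  qed
  show ?thesis
  proof (rule LIMSEQ_I)
    fix \<epsilon> :: real assume \<epsilon>: "\<epsilon> > 0"
    have "finite ({i. \<epsilon> \<le> blinfun_apply f (x i - y)} \<union> {i. \<epsilon> \<le> blinfun_apply (- f) (x i - y)})"
      using key[OF \<epsilon>] by simp
    then obtain n where n: "\<And>i. i \<in> {i. \<epsilon> \<le> blinfun_apply f (x i - y)} \<union> {i. \<epsilon> \<le> blinfun_apply (- f) (x i - y)} \<Longrightarrow> i < n"
      by (metis finite_nat_bounded lessThan_iff subsetD)
    have "norm (blinfun_apply f (x i) - blinfun_apply f y) < \<epsilon>" if "i \<ge> n" for i
    proof -
      have "\<not> \<epsilon> \<le> blinfun_apply f (x i - y)" "\<not> \<epsilon> \<le> blinfun_apply (- f) (x i - y)"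
        using n[of i] that by auto
      then show ?thesis by (auto simp: blinfun.diff_right blinfun.minus_left abs_less_iff)
    qed
    then show "\<exists>n. \<forall>i\<ge>n. norm (blinfun_apply f (x i) - blinfun_apply f y) < \<epsilon>" by blast
  qed
qed

section \<open>Weak sequential compactness implies weak compactness\<close>

lemma convex_hull_range_sum:
  fixes a :: "nat \<Rightarrow> 'a::real_vector"
  assumes "z \<in> convex hull (range a)"
  obtains n w where "z = (\<Sum>i<n. w i *\<^sub>R a i)"
proof -
  obtain S u where S: "finite S" "S \<subseteq> range a" "(\<Sum>v\<in>S. u v *\<^sub>R v) = z"
    using assms unfolding convex_hull_explicit by blast
  obtain I where I: "inj_on a I" "S = a ` I" using S(2) unfolding subset_image_inj by blast
  have finI: "finite I" using S(1) I by (simp add: finite_image_iff)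
  then obtain n where n: "I \<subseteq> {..<n}" using finite_nat_bounded by blast
  have "z = (\<Sum>i\<in>I. u (a i) *\<^sub>R a i)"
    using S(3) I by (simp add: sum.reindex)
  also have "\<dots> = (\<Sum>i<n. (if i \<in> I then u (a i) else 0) *\<^sub>R a i)"
    using n by (intro sum.mono_neutral_cong_left) auto
  finally show ?thesis by (rule that)
qed

text \<open>Rational coefficients suffice for norm approximation. In the proof below this leaves countably many combinations,
each of which can be named before the sequence is complete.\<close>

lemma rational_combination_approx:
  fixes a :: "nat \<Rightarrow> 'a::real_normed_vector"
  assumes "z \<in> convex hull (range a)" "\<epsilon> > 0"
  obtains c :: "rat list" where "norm (z - (\<Sum>i<length c. of_rat (c ! i) *\<^sub>R a i)) < \<epsilon>"
proof -
  obtain n w where z: "z = (\<Sum>i<n. w i *\<^sub>R a i)" using convex_hull_range_sum[OF assms(1)] .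
  define K where "K = (\<Sum>i<n. norm (a i)) + 1"
  have K: "K > 0" unfolding K_def by (intro add_nonneg_pos sum_nonneg) auto
  have "\<exists>q::rat. \<bar>w i - of_rat q\<bar> < \<epsilon> / K" for i
  proof -
    have "w i - \<epsilon> / K < w i" using K assms(2) by simp
    then obtain q :: rat where "w i - \<epsilon> / K < of_rat q" "of_rat q < w i" using of_rat_dense by blast
    then show ?thesis by (intro exI[of _ q]) auto
  qed
  then obtain q :: "nat \<Rightarrow> rat" where q: "\<And>i. \<bar>w i - of_rat (q i)\<bar> < \<epsilon> / K" by metis
  have "norm (z - (\<Sum>i<n. of_rat (q i) *\<^sub>R a i)) = norm (\<Sum>i<n. (w i - of_rat (q i)) *\<^sub>R a i)"
    by (simp add: z sum_subtractf scaleR_diff_left)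
  also have "\<dots> \<le> (\<Sum>i<n. \<epsilon> / K * norm (a i))"
  proof (rule sum_norm_le)
    show "norm ((w i - of_rat (q i)) *\<^sub>R a i) \<le> \<epsilon> / K * norm (a i)" for i
      using mult_right_mono[OF less_imp_le[OF q[of i]], of "norm (a i)"] by simp
  qed
  also have "\<dots> = \<epsilon> / K * (K - 1)" by (simp add: K_def sum_distrib_left)
  also have "\<dots> < \<epsilon> / K * K" using K assms(2) by (intro mult_strict_left_mono) auto
  also have "\<dots> = \<epsilon>" using K by simp
  finally have "norm (z - (\<Sum>i<n. of_rat (q i) *\<^sub>R a i)) < \<epsilon>" .
  moreover have "(\<Sum>i<length (map q [0..<n]). of_rat (map q [0..<n] ! i) *\<^sub>R a i) = (\<Sum>i<n. of_rat (q i) *\<^sub>R a i)"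
    by simp
  ultimately show ?thesis using that[of "map q [0..<n]"] by simp
qed

lemma half_norming_functional:
  fixes F :: "('a::real_normed_vector \<Rightarrow>\<^sub>L real) \<Rightarrow> real"
  assumes bdd: "\<And>g. norm g \<le> 1 \<Longrightarrow> \<bar>F g\<bar> \<le> K"
  shows "\<exists>g. norm g \<le> 1 \<and> (\<forall>h. norm h \<le> 1 \<longrightarrow> \<bar>F h\<bar> \<le> 2 * \<bar>F g\<bar>)"
proof -
  define S where "S = (\<lambda>g. \<bar>F g\<bar>) ` {g. norm g \<le> 1}"
  have S: "S \<noteq> {}" "bdd_above S" "\<And>g. norm g \<le> 1 \<Longrightarrow> \<bar>F g\<bar> \<in> S"
    using bdd by (auto simp: S_def intro!: bdd_aboveI[of _ K] exI[of _ 0])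
  show ?thesis
  proof (cases "Sup S > 0")
    case True
    then have "Sup S / 2 < Sup S" by simp
    then obtain v where "v \<in> S" "Sup S / 2 < v" using less_cSupD[OF S(1)] by blast
    then obtain g where g: "norm g \<le> 1" "Sup S / 2 < \<bar>F g\<bar>" by (auto simp: S_def)
    have "\<bar>F h\<bar> \<le> 2 * \<bar>F g\<bar>" if "norm h \<le> 1" for h
      using cSup_upper[OF S(3)[OF that] S(2)] g(2) by linarith
    then show ?thesis using g(1) by blast
  next
    case False
    have "\<bar>F h\<bar> \<le> 2 * \<bar>F 0\<bar>" if "norm h \<le> 1" for h
      using cSup_upper[OF S(3)[OF that] S(2)] False by linarith
    then show ?thesis by (intro exI[of _ 0]) simp
  qed
qed

text \<open>Whitley's argument for the Eberlein-Smulian theorem: \<open>\<Phi>\<close> is a point of the weak-star closure of \<open>A\<close> in the bidual. A sequence \<open>a n\<close> in \<open>A\<close> is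
chosen so that it approximates \<open>\<Phi>\<close> on more and more functionals, each of them half-norming for one of the countably many elements
\<open>\<Phi> - \<Sum>\<^sub>i c\<^sub>i a\<^sub>i\<close> with rational coefficients. If \<open>y \<in> A\<close> is a weak limit of a
subsequence, then \<open>\<Phi>\<close> and \<open>y\<close> agree on all of these functionals. Since \<open>y\<close> is a norm limit of combinations of the \<open>a\<^sub>i\<close>, the
distance of \<open>\<Phi>\<close> and \<open>y\<close> is estimated by their difference on these functionals, hence it vanishes.\<close>

lemma bidual_limit_represented:
  fixes B :: "('a::banach \<Rightarrow>\<^sub>L real) set" and A :: "'a set" and \<Phi> :: "('a \<Rightarrow>\<^sub>L real) \<Rightarrow> real"
  assumes B: "is_boundary B" and A: "bounded A"
    and seq: "\<forall>x::nat \<Rightarrow> 'a. range x \<subseteq> A \<longrightarrow> (\<exists>r y. strict_mono r \<and> y \<in> A \<and>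
       (\<forall>g::'a \<Rightarrow>\<^sub>L real. (\<lambda>i. blinfun_apply g (x (r i))) \<longlonglongrightarrow> blinfun_apply g y))"
    and approx: "\<forall>G \<epsilon>. finite G \<longrightarrow> \<epsilon> > 0 \<longrightarrow> (\<exists>a\<in>A. \<forall>g\<in>G. \<bar>\<Phi> g - blinfun_apply g a\<bar> < \<epsilon>)"
  shows "\<exists>y\<in>A. \<forall>g. \<Phi> g = blinfun_apply g y"
proof -
  obtain C where C: "\<And>a. a \<in> A \<Longrightarrow> norm a \<le> C" using A by (auto simp: bounded_iff)
  have \<Phi>_bound: "\<bar>\<Phi> g\<bar> \<le> C + 1" if g: "norm g \<le> 1" for g
  proof -
    obtain a where a: "a \<in> A" "\<bar>\<Phi> g - blinfun_apply g a\<bar> < 1" using approx[rule_format, of "{g}" 1] by auto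
    have "\<bar>blinfun_apply g a\<bar> \<le> norm g * norm a" using norm_blinfun[of g a] by simp
    also have "\<dots> \<le> 1 * C" using g C[OF a(1)] by (intro mult_mono) auto
    finally show ?thesis using a(2) by linarith
  qed
  have \<Phi>_scale: "\<Phi> (c *\<^sub>R g) = c * \<Phi> g" for c g
  proof -
    have "\<bar>\<Phi> (c *\<^sub>R g) - c * \<Phi> g\<bar> \<le> 0 + \<epsilon>" if "\<epsilon> > 0" for \<epsilon>
    proof -
      define \<delta> where "\<delta> = \<epsilon> / (1 + \<bar>c\<bar>)"
      have \<delta>: "\<delta> > 0" "(1 + \<bar>c\<bar>) * \<delta> = \<epsilon>" using that by (auto simp: \<delta>_def add_pos_nonneg)
      obtain a where a: "\<bar>\<Phi> (c *\<^sub>R g) - c * blinfun_apply g a\<bar> < \<delta>" "\<bar>\<Phi> g - blinfun_apply g a\<bar> < \<delta>"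
        using approx[rule_format, of "{c *\<^sub>R g, g}" \<delta>] \<delta>(1) by (auto simp: blinfun.scaleR_left)
      have "\<bar>c * \<Phi> g - c * blinfun_apply g a\<bar> \<le> \<bar>c\<bar> * \<delta>"
        using a(2) by (simp add: right_diff_distrib[symmetric] abs_mult mult_left_mono)
      then have "\<bar>\<Phi> (c *\<^sub>R g) - c * \<Phi> g\<bar> \<le> \<delta> + \<bar>c\<bar> * \<delta>" using a(1) by linarith
      then show ?thesis using \<delta>(2) by (simp add: algebra_simps)
    qed
    then have "\<bar>\<Phi> (c *\<^sub>R g) - c * \<Phi> g\<bar> \<le> 0" by (rule field_le_epsilon)
    then show ?thesis by simp
  qed
  define F where "F = (\<lambda>(a::nat \<Rightarrow> 'a) (c::rat list) g. \<Phi> g - blinfun_apply g (\<Sum>i<length c. of_rat (c ! i) *\<^sub>R a i))"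
  \<comment> \<open>The element \<open>F a c\<close> depends on \<open>a i\<close> for \<open>i < length c\<close> only, which makes the recursive choice of \<open>a n\<close> below well-founded.\<close>
  have F_cong: "F a c = F a' c" if "\<And>i. i < length c \<Longrightarrow> a i = a' i" for a a' c
    using that by (simp add: F_def)
  have F_ex: "\<exists>g. norm g \<le> 1 \<and> (\<forall>h. norm h \<le> 1 \<longrightarrow> \<bar>F a c h\<bar> \<le> 2 * \<bar>F a c g\<bar>)" for a c
  proof (rule half_norming_functional)
    fix g :: "'a \<Rightarrow>\<^sub>L real" assume g: "norm g \<le> 1"
    define s where "s = (\<Sum>i<length c. of_rat (c ! i) *\<^sub>R a i)"
    have "\<bar>blinfun_apply g s\<bar> \<le> norm g * norm s" using norm_blinfun[of g s] by simp
    also have "\<dots> \<le> 1 * norm s" using g by (intro mult_right_mono) auto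
    finally show "\<bar>F a c g\<bar> \<le> C + 1 + norm s" using \<Phi>_bound[OF g] by (simp add: F_def s_def[symmetric])
  qed
  define \<gamma> where "\<gamma> = (\<lambda>f::('a \<Rightarrow>\<^sub>L real) \<Rightarrow> real. SOME g. norm g \<le> 1 \<and> (\<forall>h. norm h \<le> 1 \<longrightarrow> \<bar>f h\<bar> \<le> 2 * \<bar>f g\<bar>))"
  have \<gamma>: "norm (\<gamma> (F a c)) \<le> 1" "norm h \<le> 1 \<Longrightarrow> \<bar>F a c h\<bar> \<le> 2 * \<bar>F a c (\<gamma> (F a c))\<bar>" for a c h
    using someI_ex[OF F_ex[of a c]] unfolding \<gamma>_def by auto
  have "\<exists>a. \<forall>n. a n \<in> A \<and> (\<forall>c. to_nat c < n \<longrightarrow> length c \<le> n \<longrightarrow>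
      \<bar>\<Phi> (\<gamma> (F a c)) - blinfun_apply (\<gamma> (F a c)) (a n)\<bar> < inverse (real (Suc n)))"
  proof (rule dependent_wellorder_choice)
    fix r :: 'a and f g :: "nat \<Rightarrow> 'a" and n
    assume fg: "\<And>m. m < n \<Longrightarrow> f m = g m"
    have "F f c = F g c" if "length c \<le> n" for c using fg that by (intro F_cong) auto
    then show "(r \<in> A \<and> (\<forall>c. to_nat c < n \<longrightarrow> length c \<le> n \<longrightarrow>
        \<bar>\<Phi> (\<gamma> (F f c)) - blinfun_apply (\<gamma> (F f c)) r\<bar> < inverse (real (Suc n)))) =
      (r \<in> A \<and> (\<forall>c. to_nat c < n \<longrightarrow> length c \<le> n \<longrightarrow>
        \<bar>\<Phi> (\<gamma> (F g c)) - blinfun_apply (\<gamma> (F g c)) r\<bar> < inverse (real (Suc n))))"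
      by simp
  next
    fix n and f :: "nat \<Rightarrow> 'a"
    have "{c::rat list. to_nat c < n} = to_nat -` {..<n}" by auto
    then have "finite ((\<lambda>c. \<gamma> (F f c)) ` {c::rat list. to_nat c < n})"
      by (intro finite_imageI) (simp add: finite_vimageI)
    then have "\<exists>a\<in>A. \<forall>g\<in>(\<lambda>c. \<gamma> (F f c)) ` {c::rat list. to_nat c < n}.
        \<bar>\<Phi> g - blinfun_apply g a\<bar> < inverse (real (Suc n))"
      by (rule approx[rule_format]) simp
    then obtain r where r: "r \<in> A"
      "\<forall>g\<in>(\<lambda>c. \<gamma> (F f c)) ` {c::rat list. to_nat c < n}. \<bar>\<Phi> g - blinfun_apply g r\<bar> < inverse (real (Suc n))"
      by (elim bexE)
    show "\<exists>r. r \<in> A \<and> (\<forall>c. to_nat c < n \<longrightarrow> length c \<le> n \<longrightarrow>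
        \<bar>\<Phi> (\<gamma> (F f c)) - blinfun_apply (\<gamma> (F f c)) r\<bar> < inverse (real (Suc n)))"
      by (intro exI[of _ r] conjI r(1) allI impI r(2)[rule_format]) simp
  qed
  then obtain a where a': "\<forall>n. a n \<in> A \<and> (\<forall>c. to_nat c < n \<longrightarrow> length c \<le> n \<longrightarrow>
      \<bar>\<Phi> (\<gamma> (F a c)) - blinfun_apply (\<gamma> (F a c)) (a n)\<bar> < inverse (real (Suc n)))" by (elim exE)
  have a: "a n \<in> A" "\<And>c. to_nat c < n \<Longrightarrow> length c \<le> n \<Longrightarrow>
      \<bar>\<Phi> (\<gamma> (F a c)) - blinfun_apply (\<gamma> (F a c)) (a n)\<bar> < inverse (real (Suc n))" for n
    using a'[THEN spec, of n] by blast+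
  have "range a \<subseteq> A" using a(1) by blast
  from seq[rule_format, OF this] obtain r y where r: "strict_mono r" and y: "y \<in> A"
    "\<forall>g::'a \<Rightarrow>\<^sub>L real. (\<lambda>i. blinfun_apply g (a (r i))) \<longlonglongrightarrow> blinfun_apply g y"
    by (elim exE conjE)
  have \<gamma>_eq: "\<Phi> (\<gamma> (F a c)) = blinfun_apply (\<gamma> (F a c)) y" for c
  proof -
    let ?g = "\<gamma> (F a c)"
    have "(\<lambda>n. blinfun_apply ?g (a n) - \<Phi> ?g) \<longlonglongrightarrow> 0"
    proof (rule Lim_null_comparison[OF _ LIMSEQ_inverse_real_of_nat])
      show "\<forall>\<^sub>F n in sequentially. norm (blinfun_apply ?g (a n) - \<Phi> ?g) \<le> inverse (real (Suc n))"
        using eventually_gt_at_top[of "to_nat c"] eventually_ge_at_top[of "length c"]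
      proof eventually_elim
        case (elim n)
        then show ?case using a(2)[of c n] by (simp add: abs_minus_commute less_imp_le)
      qed
    qed
    then have "(\<lambda>n. blinfun_apply ?g (a n)) \<longlonglongrightarrow> \<Phi> ?g" by (simp add: LIM_zero_iff)
    from LIMSEQ_subseq_LIMSEQ[OF this r] have "(\<lambda>i. blinfun_apply ?g (a (r i))) \<longlonglongrightarrow> \<Phi> ?g"
      by (simp add: o_def)
    then show ?thesis by (rule LIMSEQ_unique[OF _ y(2)[rule_format]])
  qed
  have ball: "\<bar>\<Phi> h - blinfun_apply h y\<bar> \<le> 0" if h: "norm h \<le> 1" for h
  proof (rule field_le_epsilon)
    fix \<epsilon> :: real assume \<epsilon>: "\<epsilon> > 0"
    define \<delta> where "\<delta> = \<epsilon> / 6"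
    have \<delta>: "\<delta> > 0" using \<epsilon> by (simp add: \<delta>_def)
    have "bounded (range (a \<circ> r))" by (rule bounded_subset[OF A]) (use a(1) in auto)
    moreover have "(\<lambda>i. blinfun_apply b ((a \<circ> r) i)) \<longlonglongrightarrow> blinfun_apply b y"
      for b :: "'a \<Rightarrow>\<^sub>L real" using y(2) by simp
    ultimately obtain z where z: "z \<in> convex hull (range (a \<circ> r))" "norm (z - y) < \<delta>"
      using boundary_mazur[OF B _ _ \<delta>, of "a \<circ> r" y] by blast
    have "convex hull (range (a \<circ> r)) \<subseteq> convex hull (range a)" by (intro hull_mono) auto
    then obtain c :: "rat list" where c: "norm (z - (\<Sum>i<length c. of_rat (c ! i) *\<^sub>R a i)) < \<delta>"
      using rational_combination_approx[rule_format, of z a \<delta>] z(1) \<delta> by blast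
    define s where "s = (\<Sum>i<length c. of_rat (c ! i) *\<^sub>R a i)"
    have "norm (s - y) \<le> norm (s - z) + norm (z - y)"
      using norm_triangle_ineq[of "s - z" "z - y"] by simp
    then have sy: "norm (s - y) \<le> 2 * \<delta>" using c z(2) by (simp add: s_def[symmetric] norm_minus_commute)
    have small: "\<bar>blinfun_apply g s - blinfun_apply g y\<bar> \<le> 2 * \<delta>" if "norm g \<le> 1" for g
    proof -
      have "\<bar>blinfun_apply g (s - y)\<bar> \<le> norm g * norm (s - y)" using norm_blinfun[of g "s - y"] by simp
      also have "\<dots> \<le> 1 * norm (s - y)" using that by (intro mult_right_mono) auto
      finally show ?thesis using sy by (simp add: blinfun.diff_right)
    qed
    let ?g = "\<gamma> (F a c)"
    have F: "F a c g = \<Phi> g - blinfun_apply g s" for g by (simp add: F_def s_def)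
    have "\<bar>\<Phi> h - blinfun_apply h s\<bar> \<le> 2 * \<bar>\<Phi> ?g - blinfun_apply ?g s\<bar>"
      using \<gamma>(2)[OF h, of a c] unfolding F .
    also have "\<dots> \<le> 2 * (2 * \<delta>)"
      using small[OF \<gamma>(1)] \<gamma>_eq[of c] by (simp add: abs_minus_commute)
    finally have "\<bar>\<Phi> h - blinfun_apply h s\<bar> \<le> 2 * (2 * \<delta>)" .
    moreover have "6 * \<delta> = \<epsilon>" by (simp add: \<delta>_def)
    ultimately show "\<bar>\<Phi> h - blinfun_apply h y\<bar> \<le> 0 + \<epsilon>" using small[OF h] by linarith
  qed
  have "\<Phi> g = blinfun_apply g y" for g
  proof (cases "g = 0")
    case True
    then show ?thesis using \<Phi>_scale[of 0 0] by simp
  next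
    case False
    have "norm ((1 / norm g) *\<^sub>R g) \<le> 1" using False by simp
    from ball[OF this] have "\<Phi> ((1 / norm g) *\<^sub>R g) = blinfun_apply ((1 / norm g) *\<^sub>R g) y" by simp
    then show ?thesis using False by (simp only: \<Phi>_scale blinfun.scaleR_left real_scaleR_def) simp
  qed
  then show ?thesis using y(1) by blast
qed

text \<open>Under evaluation, \<open>A\<close> becomes a subset of a product of compact intervals. The hypothesis says that this subset is closed, so that
Tychonoff's theorem applies.\<close>

lemma compactin_weak_topologyI:
  fixes A :: "'a::real_normed_vector set"
  assumes A: "bounded A"
    and rep: "\<And>\<Phi> :: ('a \<Rightarrow>\<^sub>L real) \<Rightarrow> real. \<forall>G \<epsilon>. finite G \<longrightarrow> \<epsilon> > 0 \<longrightarrow> (\<exists>a\<in>A. \<forall>g\<in>G. \<bar>\<Phi> g - blinfun_apply g a\<bar> < \<epsilon>) \<Longrightarrow>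
       \<exists>y\<in>A. \<forall>g. \<Phi> g = blinfun_apply g y"
  shows "compactin weak_topology A"
proof -
  define E where "E = (\<lambda>(a::'a) (g::'a \<Rightarrow>\<^sub>L real). blinfun_apply g a)"
  let ?P = "product_topology (\<lambda>_::'a \<Rightarrow>\<^sub>L real. euclideanreal) UNIV"
  obtain C where C: "\<And>a. a \<in> A \<Longrightarrow> norm a \<le> C" using A by (auto simp: bounded_iff)
  have "compactin ?P (PiE UNIV (\<lambda>g. {- (norm g * C)..norm g * C}))"
    by (simp add: compactin_PiE)
  moreover have "E ` A \<subseteq> PiE UNIV (\<lambda>g. {- (norm g * C)..norm g * C})"
  proof -
    have "\<bar>blinfun_apply g a\<bar> \<le> norm g * C" if "a \<in> A" for a g
      using norm_blinfun[of g a] mult_left_mono[OF C[OF that], of "norm g"] by simp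
    then show ?thesis by (auto simp: E_def abs_le_iff minus_le_iff)
  qed
  moreover have "closedin ?P (E ` A)"
    unfolding closure_of_subset_eq[symmetric]
  proof (intro conjI subsetI)
    fix \<Phi> assume \<Phi>: "\<Phi> \<in> ?P closure_of (E ` A)"
    have "\<exists>a\<in>A. \<forall>g\<in>G. \<bar>\<Phi> g - blinfun_apply g a\<bar> < \<epsilon>" if G: "finite G" "\<epsilon> > 0" for G \<epsilon>
    proof -
      define T where "T = PiE UNIV (\<lambda>g. if g \<in> G then ball (\<Phi> g) \<epsilon> else UNIV)"
      have "{g. (if g \<in> G then ball (\<Phi> g) \<epsilon> else UNIV) \<noteq> UNIV} \<subseteq> G" by auto
      then have "openin ?P T"
        unfolding T_def openin_PiE_gen using G(1) by (auto intro: finite_subset)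
      moreover have "\<Phi> \<in> T" using G(2) by (simp add: T_def PiE_UNIV_domain)
      ultimately obtain a where "a \<in> A" "E a \<in> T" using \<Phi> unfolding in_closure_of by blast
      then show ?thesis by (force simp: T_def E_def dist_real_def PiE_UNIV_domain split: if_splits)
    qed
    then have "\<exists>y\<in>A. \<forall>g. \<Phi> g = blinfun_apply g y" by (intro rep) simp
    then show "\<Phi> \<in> E ` A" unfolding E_def by (auto simp: fun_eq_iff image_iff)
  qed auto
  ultimately have comp: "compactin ?P (E ` A)" by (rule closed_compactin)
  have weak: "weak_topology = pullback_topology UNIV E ?P"
    by (simp add: weak_topology_def sigma_topology_def E_def restrict_UNIV)
  show ?thesis
    unfolding compactin_def
  proof (intro conjI allI impI)
    show "A \<subseteq> topspace weak_topology" by (simp add: weak_topology_def)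
    fix \<U> assume \<U>: "Ball \<U> (openin weak_topology) \<and> A \<subseteq> \<Union>\<U>"
    then have "\<forall>U\<in>\<U>. \<exists>V. openin ?P V \<and> U = E -` V"
      unfolding weak openin_pullback_topology by simp
    then obtain V where V: "\<And>U. U \<in> \<U> \<Longrightarrow> openin ?P (V U)" "\<And>U. U \<in> \<U> \<Longrightarrow> U = E -` V U" by metis
    have "Ball (V ` \<U>) (openin ?P)" using V(1) by simp
    moreover have "E ` A \<subseteq> \<Union>(V ` \<U>)" using \<U> V(2) by blast
    ultimately obtain \<F> where \<F>: "finite \<F>" "\<F> \<subseteq> V ` \<U>" "E ` A \<subseteq> \<Union>\<F>"
      using comp[unfolded compactin_def, THEN conjunct2, THEN spec, of "V ` \<U>"] by (elim impE) auto
    obtain \<G> where \<G>: "\<G> \<subseteq> \<U>" "finite \<G>" "\<F> = V ` \<G>" using finite_subset_image[OF \<F>(1,2)] by blast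
    have "A \<subseteq> \<Union>\<G>"
    proof
      fix a assume "a \<in> A"
      then obtain U where "U \<in> \<G>" "E a \<in> V U" using \<F>(3) \<G>(3) by blast
      then show "a \<in> \<Union>\<G>" using V(2)[of U] \<G>(1) by blast
    qed
    then show "\<exists>\<F>. finite \<F> \<and> \<F> \<subseteq> \<U> \<and> A \<subseteq> \<Union>\<F>" using \<G> by blast
  qed
qed

lemma intermediate_imp_weakly_compact:
  fixes B :: "('a::banach \<Rightarrow>\<^sub>L real) set" and A :: "'a set"
  assumes B: "is_boundary B" and A: "bounded A"
    and cl: "\<forall>x. range x \<subseteq> A \<longrightarrow> (\<exists>y\<in>A. intermediate B x UNIV y)"
  shows "compactin weak_topology A"
proof (rule compactin_weak_topologyI[OF A])
  have "\<forall>x::nat \<Rightarrow> 'a. range x \<subseteq> A \<longrightarrow> (\<exists>r y. strict_mono r \<and> y \<in> A \<and>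
      (\<forall>g::'a \<Rightarrow>\<^sub>L real. (\<lambda>i. blinfun_apply g (x (r i))) \<longlonglongrightarrow> blinfun_apply g y))"
  proof (intro allI impI)
    fix x :: "nat \<Rightarrow> 'a" assume x: "range x \<subseteq> A"
    obtain r y where r: "strict_mono r" "y \<in> A"
      "\<forall>b\<in>B. (\<lambda>i. blinfun_apply b (x (r i))) \<longlonglongrightarrow> blinfun_apply b y"
      using sigma_convergent_subsequence[OF B A cl x] by (elim exE conjE)
    have "bounded (range (\<lambda>i. x (r i)))" by (rule bounded_subset[OF A]) (use x in auto)
    then have "(\<lambda>i. blinfun_apply g (x (r i))) \<longlonglongrightarrow> blinfun_apply g y" for g :: "'a \<Rightarrow>\<^sub>L real"
      using rainwater_simons[OF B, of "\<lambda>i. x (r i)" y g] r(3) by simp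
    then show "\<exists>r y. strict_mono r \<and> y \<in> A \<and>
        (\<forall>g::'a \<Rightarrow>\<^sub>L real. (\<lambda>i. blinfun_apply g (x (r i))) \<longlonglongrightarrow> blinfun_apply g y)"
      using r(1,2) by (intro exI[of _ r] exI[of _ y]) simp
  qed
  then show "\<exists>y\<in>A. \<forall>g. \<Phi> g = blinfun_apply g y"
    if "\<forall>G \<epsilon>. finite G \<longrightarrow> \<epsilon> > 0 \<longrightarrow> (\<exists>a\<in>A. \<forall>g\<in>G. \<bar>\<Phi> g - blinfun_apply g a\<bar> < \<epsilon>)"
    for \<Phi> :: "('a \<Rightarrow>\<^sub>L real) \<Rightarrow> real"
    using that by (rule bidual_limit_represented[OF B A])
qed

section \<open>Comparison of the topologies and of the four conditions\<close>

lemma continuous_map_sigma_topology: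
  fixes B :: "('a::real_normed_vector \<Rightarrow>\<^sub>L real) set"
  assumes "f \<in> span B"
  shows "continuous_map (sigma_topology B) euclideanreal (blinfun_apply f)"
  using assms
proof (induction rule: span_induct_alt)
  case base
  then show ?case by (simp add: zero_blinfun.rep_eq)
next
  case (step c b f)
  have "continuous_map (sigma_topology B) euclideanreal ((\<lambda>h. h b) \<circ> (\<lambda>x. \<lambda>b\<in>B. blinfun_apply b x))"
    unfolding sigma_topology_def
    by (intro continuous_map_pullback continuous_map_product_projection step)
  then have "continuous_map (sigma_topology B) euclideanreal (blinfun_apply b)"
    using step by (simp add: o_def)
  then show ?case
    using step by (simp add: plus_blinfun.rep_eq scaleR_blinfun.rep_eq continuous_map_add continuous_map_real_mult_left)
qed

lemma openin_sigma_imp_weak: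
  fixes B :: "('a::real_normed_vector \<Rightarrow>\<^sub>L real) set"
  assumes "openin (sigma_topology B) U"
  shows "openin weak_topology U"
proof -
  obtain V where V: "openin (product_topology (\<lambda>_. euclideanreal) B) V"
    "U = (\<lambda>x. \<lambda>b\<in>B. blinfun_apply b x) -` V \<inter> UNIV"
    using assms unfolding sigma_topology_def openin_pullback_topology by blast
  have "continuous_map weak_topology (product_topology (\<lambda>_. euclideanreal) B) (\<lambda>x. \<lambda>b\<in>B. blinfun_apply b x)"
    unfolding continuous_map_componentwise weak_topology_def
    using continuous_map_sigma_topology[of _ "UNIV :: ('a \<Rightarrow>\<^sub>L real) set"] by (auto simp: span_UNIV)
  from openin_continuous_map_preimage[OF this V(1)] show ?thesis
    using V(2) by (simp add: weak_topology_def vimage_def)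
qed

lemma weakly_compact_imp_sigma_countably_compact:
  fixes B :: "('a::real_normed_vector \<Rightarrow>\<^sub>L real) set"
  assumes comp: "compactin weak_topology A"
  shows "countably_compactin (sigma_topology B) A"
  unfolding countably_compactin_def
proof (intro conjI allI impI)
  fix s :: "nat \<Rightarrow> 'a" assume s: "range s \<subseteq> A"
  show "\<exists>x\<in>A. seq_cluster_point (sigma_topology B) s x"
  proof (rule ccontr)
    assume "\<not> ?thesis"
    then have "\<forall>x\<in>A. \<exists>U. openin (sigma_topology B) U \<and> x \<in> U \<and> \<not> (\<exists>\<^sub>F n in sequentially. s n \<in> U)"
      unfolding seq_cluster_point_def by auto
    then obtain U where U: "\<And>x. x \<in> A \<Longrightarrow> openin (sigma_topology B) (U x)" "\<And>x. x \<in> A \<Longrightarrow> x \<in> U x"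
      "\<And>x. x \<in> A \<Longrightarrow> \<forall>\<^sub>F n in sequentially. s n \<notin> U x" unfolding not_frequently by metis
    have "Ball (U ` A) (openin weak_topology) \<and> A \<subseteq> \<Union>(U ` A)" using U(1,2) openin_sigma_imp_weak by blast
    then obtain \<F> where "finite \<F>" "\<F> \<subseteq> U ` A" "A \<subseteq> \<Union>\<F>"
      using comp unfolding compactin_def by meson
    then obtain D where D: "finite D" "D \<subseteq> A" "A \<subseteq> \<Union>(U ` D)" by (metis finite_subset_image)
    have "\<forall>\<^sub>F n in sequentially. \<forall>x\<in>D. s n \<notin> U x"
      using D U(3) by (intro eventually_ball_finite) auto
    then obtain n where "\<forall>x\<in>D. s n \<notin> U x" using eventually_happens by force
    then show False using D(3) s by blast
  qed
qed auto

lemma cluster_point_in_closure_hull: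
  assumes "seq_cluster_point T x y"
  shows "y \<in> T closure_of (convex hull {x n | n. n \<ge> k})"
  unfolding in_closure_of
proof (intro conjI allI impI)
  show "y \<in> topspace T" using assms by (simp add: seq_cluster_point_def)
  fix U assume "y \<in> U \<and> openin T U"
  then have "\<exists>\<^sub>F n in sequentially. x n \<in> U" using assms by (auto simp: seq_cluster_point_def)
  then obtain n where "n \<ge> k" "x n \<in> U" unfolding frequently_sequentially by blast
  then show "\<exists>z. z \<in> convex hull {x n | n. n \<ge> k} \<and> z \<in> U"
    by (intro exI[of _ "x n"]) (auto intro!: hull_inc)
qed

text \<open>A half-space \<open>f \<le> c\<close> with \<open>f \<in> span B\<close> is convex and \<open>\<sigma>\<^sub>B\<close>-closed, so it contains the closed hull of every tail that it contains.\<close>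

lemma closure_hull_le_limsup:
  fixes B :: "('a::real_normed_vector \<Rightarrow>\<^sub>L real) set"
  assumes y: "\<And>k. y \<in> sigma_topology B closure_of (convex hull {x n | n. n \<ge> k})" and f: "f \<in> span B"
  shows "ereal (blinfun_apply f y) \<le> limsup (\<lambda>n. ereal (blinfun_apply f (x n)))"
  unfolding limsup_INF_SUP
proof (rule INF_greatest)
  fix k :: nat
  show "ereal (blinfun_apply f y) \<le> (SUP n\<in>{k..}. ereal (blinfun_apply f (x n)))"
  proof (rule ereal_le_real)
    fix c assume c: "(SUP n\<in>{k..}. ereal (blinfun_apply f (x n))) \<le> ereal c"
    then have xc: "blinfun_apply f (x n) \<le> c" if "n \<ge> k" for n
      using that by (simp add: SUP_le_iff)
    have "{z. blinfun_apply f z \<le> c} = blinfun_apply f -` {..c}" by auto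
    then have "convex {z. blinfun_apply f z \<le> c}"
      using convex_linear_vimage[of "blinfun_apply f" "{..c}"] convex_real_interval(2)[of c]
      by (simp add: bounded_linear.linear blinfun.bounded_linear_right)
    then have "convex hull {x n | n. n \<ge> k} \<subseteq> {z. blinfun_apply f z \<le> c}"
      using xc by (intro hull_minimal) auto
    moreover have "closedin (sigma_topology B) {z. blinfun_apply f z \<le> c}"
      using closedin_continuous_map_preimage[OF continuous_map_sigma_topology[OF f], of "{..c}"] by simp
    ultimately have "sigma_topology B closure_of (convex hull {x n | n. n \<ge> k}) \<subseteq> {z. blinfun_apply f z \<le> c}"
      by (rule closure_of_minimal)
    then show "ereal (blinfun_apply f y) \<le> ereal c" using y[of k] by auto
  qed
qed

text \<open>The lower bounds come from applying the hypothesis to \<open>- b\<close>, which belongs to \<open>span B\<close>.\<close>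

lemma le_limsup_imp_intermediate:
  assumes y: "\<forall>f\<in>span B. ereal (blinfun_apply f y) \<le> limsup (\<lambda>n. ereal (blinfun_apply f (x n)))"
  shows "intermediate B x UNIV y"
proof -
  have le: "blinfun_apply f y \<le> c" if f: "f \<in> span B" and fin: "finite {n. c < blinfun_apply f (x n)}" for f c
  proof -
    have "\<forall>\<^sub>F n in cofinite. \<not> c < blinfun_apply f (x n)" using fin by (simp add: eventually_cofinite)
    then have "\<forall>\<^sub>F n in sequentially. ereal (blinfun_apply f (x n)) \<le> ereal c"
      unfolding cofinite_eq_sequentially by eventually_elim simp
    then have "limsup (\<lambda>n. ereal (blinfun_apply f (x n))) \<le> ereal c" by (rule Limsup_bounded)
    then show ?thesis using y f by (metis ereal_less_eq(3) order_trans)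
  qed
  show ?thesis
    unfolding intermediate_def
  proof (intro ballI allI conjI impI)
    fix b c assume b: "b \<in> B"
    show "blinfun_apply b y \<le> c" if "finite {k\<in>UNIV. c < blinfun_apply b (x k)}"
      using le[of b c] that b by (simp add: span_base)
    show "c \<le> blinfun_apply b y" if "finite {k\<in>UNIV. blinfun_apply b (x k) < c}"
      using le[of "- b" "- c"] that b by (simp add: span_base span_neg blinfun.minus_left)
  qed
qed

theorem theorem2p15:
  fixes B :: "('a::banach \<Rightarrow>\<^sub>L real) set" and A :: "'a set"
  assumes "is_boundary B" and "bounded A"
  shows "(countably_compactin (sigma_topology B) A \<longleftrightarrow> compactin weak_topology A) \<and>
    ((\<forall>x::nat \<Rightarrow> 'a. range x \<subseteq> A \<longrightarrow>
        A \<inter> (\<Inter>k. sigma_topology B closure_of (convex hull {x n | n. n \<ge> k})) \<noteq> {})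
      \<longleftrightarrow> compactin weak_topology A) \<and>
    ((\<forall>x::nat \<Rightarrow> 'a. range x \<subseteq> A \<longrightarrow>
        (\<exists>y\<in>A. \<forall>f\<in>span B. ereal (blinfun_apply f y) \<le>
           limsup (\<lambda>n. ereal (blinfun_apply f (x n)))))
      \<longleftrightarrow> compactin weak_topology A)"
  (is "(?i \<longleftrightarrow> ?iv) \<and> (?ii \<longleftrightarrow> ?iv) \<and> (?iii \<longleftrightarrow> ?iv)")
proof -
  have i_ii: ?ii if i: ?i
  proof (intro allI impI)
    fix x :: "nat \<Rightarrow> 'a" assume "range x \<subseteq> A"
    then obtain y where "y \<in> A" "seq_cluster_point (sigma_topology B) x y"
      using i unfolding countably_compactin_def by blast
    then show "A \<inter> (\<Inter>k. sigma_topology B closure_of (convex hull {x n | n. n \<ge> k})) \<noteq> {}"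
      using cluster_point_in_closure_hull by blast
  qed
  have ii_iii: ?iii if ii: ?ii
  proof (intro allI impI)
    fix x :: "nat \<Rightarrow> 'a" assume "range x \<subseteq> A"
    then have "A \<inter> (\<Inter>k. sigma_topology B closure_of (convex hull {x n | n. n \<ge> k})) \<noteq> {}"
      using ii by blast
    then obtain y where y: "y \<in> A" "\<And>k. y \<in> sigma_topology B closure_of (convex hull {x n | n. n \<ge> k})" by blast
    show "\<exists>y\<in>A. \<forall>f\<in>span B. ereal (blinfun_apply f y) \<le> limsup (\<lambda>n. ereal (blinfun_apply f (x n)))"
      by (intro bexI[OF _ y(1)] ballI closure_hull_le_limsup[OF y(2)])
  qed
  have iii_iv: ?iv if iii: ?iii
  proof (rule intermediate_imp_weakly_compact[OF assms], intro allI impI)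
    fix x :: "nat \<Rightarrow> 'a" assume "range x \<subseteq> A"
    then obtain y where "y \<in> A"
      "\<forall>f\<in>span B. ereal (blinfun_apply f y) \<le> limsup (\<lambda>n. ereal (blinfun_apply f (x n)))"
      using iii[THEN spec, of x] by (elim impE bexE)
    then show "\<exists>y\<in>A. intermediate B x UNIV y"
      by (intro bexI[of _ y] le_limsup_imp_intermediate)
  qed
  have iv_i: ?i if ?iv using that by (rule weakly_compact_imp_sigma_countably_compact)
  show ?thesis
  proof (intro conjI iffI)
    show ?iv if ?i by (rule iii_iv[OF ii_iii[OF i_ii[OF that]]])
    show ?i if ?iv by (rule iv_i[OF that])
    show ?iv if ?ii by (rule iii_iv[OF ii_iii[OF that]])
    show ?ii if ?iv by (rule i_ii[OF iv_i[OF that]])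
    show ?iv if ?iii by (rule iii_iv[OF that])
    show ?iii if ?iv by (rule ii_iii[OF i_ii[OF iv_i[OF that]]])
  qed
qed

end
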